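(* Let $F$ be a field of positive characteristic $p$ and let $L$ be a finite-dimensional, $p$-nilpotent, abelian restricted Lie algebra over $F$, with restricted enveloping algebra $u(L)$. Then $u(L)$ has a filtered multiplicative basis if and only if $L$ decomposes as a direct sum of cyclic restricted subalgebras. In particular, if $F$ is a perfect field, then $u(L)$ has a filtered multiplicative basis.
   Context: A restricted Lie algebra $L$ over a field $F$ of characteristic $p>0$ is a Lie algebra with a $p$-map $x\mapsto x^{[p]}$; write $x^{[p]^n}$ for the $n$-fold iterate of the $p$-map applied to $x$. $L$ is $p$-nilpotent if for every $x\in L$ there is $n\ge 1$ with $x^{[p]^n}=0$. The restricted enveloping algebra $u(L)$ is the quotient of the universal enveloping algebra $U(L)$ by the ideal generated by all $x^p-x^{[p]}$, $x\in L$. A restricted subalgebra is a Lie subalgebra closed under the $p$-map; a restricted Lie algebra is cyclic if there is an element which generates it as a restricted subalgebra. Filtered multiplicative basis: let $A$ be a finite-dimensional associative algebra over $F$ with Jacobson radical $\mathrm{rad}(A)$. An $F$-basis $\mathfrak{B}$ of $A$ is a filtered multiplicative basis of $A$ if (i) for all $b_1,b_2\in\mathfrak{B}$, either $b_1b_2=0$ or $b_1b_2\in\mathfrak{B}$; and (ii) $\mathfrak{B}\cap\mathrm{rad}(A)$ is an $F$-basis of $\mathrm{rad}(A)$. *)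

theory Defs
  imports "HOL-Algebra.QuotRing" "Jordan_Normal_Form.VS_Connect" "HOL-Library.Poly_Mapping"
begin

section \<open>Associative algebras over a field\<close>

text \<open>An associative algebra over a field \<open>K\<close> is a record of type \<^type>\<open>module\<close>, whose ring
  part need not be commutative; its linear algebra is that of the locale \<^locale>\<open>vectorspace\<close>.\<close>

locale assoc_algebra = vectorspace K A + A?: ring A for K and A (structure) +
  assumes smult_mult_left:
      "\<lbrakk>c \<in> carrier K; x \<in> carrier A; y \<in> carrier A\<rbrakk> \<Longrightarrow> (c \<odot> x) \<otimes> y = c \<odot> (x \<otimes> y)"
    and smult_mult_right:
      "\<lbrakk>c \<in> carrier K; x \<in> carrier A; y \<in> carrier A\<rbrakk> \<Longrightarrow> x \<otimes> (c \<odot> y) = c \<odot> (x \<otimes> y)"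

text \<open>The scalar multiplication on cosets follows the pattern of \<^const>\<open>rcoset_mult\<close>.\<close>

definition quotient_algebra :: "('f, 'a, 'm) module_scheme \<Rightarrow> 'a set \<Rightarrow> ('f, 'a set) module" where
  "quotient_algebra A J =
    \<lparr>carrier = carrier (A Quot J), mult = mult (A Quot J), one = one (A Quot J),
     zero = zero (A Quot J), add = add (A Quot J),
     smult = (\<lambda>c X. \<Union>x\<in>X. J +>\<^bsub>A\<^esub> (c \<odot>\<^bsub>A\<^esub> x))\<rparr>"

lemma (in assoc_algebra) smult_coset:
  assumes "ideal J A" "c \<in> carrier K" "x \<in> carrier A"
  shows "(\<Union>y\<in>J +> x. J +> (c \<odot> y)) = J +> (c \<odot> x)"
proof -
  interpret J: ideal J A by fact
  have smJ: "c \<odot> h \<in> J" if "h \<in> J" for h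
  proof -
    have h: "h \<in> carrier A" using that J.a_subset by auto
    have "(c \<odot> \<one>) \<otimes> h \<in> J" using that assms by (intro J.I_l_closed) auto
    then show ?thesis using h assms by (simp add: smult_mult_left)
  qed
  have "J +> (c \<odot> y) = J +> (c \<odot> x)" if y: "y \<in> J +> x" for y
  proof -
    obtain h where h: "h \<in> J" "y = h \<oplus> x" using y by (auto simp: a_r_coset_def r_coset_def)
    have hc: "h \<in> carrier A" using h J.a_subset by auto
    have "c \<odot> y = c \<odot> h \<oplus> c \<odot> x" using h hc assms by (simp add: smult_r_distr)
    then have "c \<odot> y \<in> J +> (c \<odot> x)" using smJ[OF h(1)] by (auto simp: a_r_coset_def r_coset_def)
    then show ?thesis using assms by (intro J.a_repr_independence'[symmetric]) auto
  qed
  moreover have "x \<in> J +> x" using assms by (intro J.a_rcos_self) auto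
  ultimately show ?thesis by blast
qed

lemma (in assoc_algebra) assoc_algebra_quotient:
  assumes "ideal J A"
  shows "assoc_algebra K (quotient_algebra A J)"
proof -
  interpret J: ideal J A by fact
  let ?Q = "quotient_algebra A J"
  have eq: "carrier ?Q = carrier (A Quot J)" "mult ?Q = mult (A Quot J)" "one ?Q = one (A Quot J)"
    "zero ?Q = zero (A Quot J)" "add ?Q = add (A Quot J)"
    by (simp_all add: quotient_algebra_def)
  interpret Q: ring "A Quot J" by (rule J.quotient_is_ring)
  have ring: "ring ?Q"
    by (intro ringI abelian_groupI Group.monoidI)
      (auto simp: eq Q.m_assoc Q.a_ac Q.l_distr Q.r_distr intro: Q.a_inv_closed Q.l_neg)
  have car: "carrier ?Q = {J +> x | x. x \<in> carrier A}"
    by (auto simp: eq FactRing_simps)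
  have add: "(J +> x) \<oplus>\<^bsub>?Q\<^esub> (J +> y) = J +> (x \<oplus> y)" if "x \<in> carrier A" "y \<in> carrier A" for x y
    using that by (simp add: eq FactRing_def J.a_rcos_sum)
  have mul: "(J +> x) \<otimes>\<^bsub>?Q\<^esub> (J +> y) = J +> (x \<otimes> y)" if "x \<in> carrier A" "y \<in> carrier A" for x y
    using that by (simp add: eq FactRing_def J.rcoset_mult_add)
  have sm: "c \<odot>\<^bsub>?Q\<^esub> (J +> x) = J +> (c \<odot> x)" if "c \<in> carrier K" "x \<in> carrier A" for c x
    using smult_coset[OF assms that] by (simp add: quotient_algebra_def)
  have "Module.module K ?Q"
  proof (rule moduleI)
    show "cring K" by (rule R.cring_axioms)
    show "abelian_group ?Q" using ring by (rule ring.is_abelian_group)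
  qed (auto simp: car add sm smult_l_distr smult_r_distr smult_assoc1)
  then have "vectorspace K ?Q"
    by (rule vectorspace.intro[OF _ field_axioms])
  then show ?thesis
    by (intro assoc_algebra.intro assoc_algebra_axioms.intro ring)
      (auto simp: car mul sm smult_mult_left smult_mult_right)
qed

definition left_ideal :: "'a set \<Rightarrow> ('a, 'm) ring_scheme \<Rightarrow> bool" where
  "left_ideal J A \<longleftrightarrow>
    additive_subgroup J A \<and> (\<forall>a\<in>carrier A. \<forall>x\<in>J. a \<otimes>\<^bsub>A\<^esub> x \<in> J)"

definition maximal_left_ideal :: "'a set \<Rightarrow> ('a, 'm) ring_scheme \<Rightarrow> bool" where
  "maximal_left_ideal M A \<longleftrightarrow> left_ideal M A \<and> M \<noteq> carrier A \<and>
    (\<forall>J. left_ideal J A \<and> M \<subseteq> J \<longrightarrow> J = M \<or> J = carrier A)"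

definition jacobson_radical :: "('a, 'm) ring_scheme \<Rightarrow> 'a set" where
  "jacobson_radical A = carrier A \<inter> \<Inter>{M. maximal_left_ideal M A}"

definition filtered_multiplicative_basis ::
    "('f, 'k) ring_scheme \<Rightarrow> ('f, 'a, 'm) module_scheme \<Rightarrow> 'a set \<Rightarrow> bool" where
  "filtered_multiplicative_basis K A B \<longleftrightarrow>
    vectorspace.basis K A B \<and>
    (\<forall>b\<^sub>1\<in>B. \<forall>b\<^sub>2\<in>B. b\<^sub>1 \<otimes>\<^bsub>A\<^esub> b\<^sub>2 = \<zero>\<^bsub>A\<^esub> \<or> b\<^sub>1 \<otimes>\<^bsub>A\<^esub> b\<^sub>2 \<in> B) \<and>
    vectorspace.basis K (A\<lparr>carrier := jacobson_radical A\<rparr>) (B \<inter> jacobson_radical A)"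

definition has_filtered_multiplicative_basis ::
    "('f, 'k) ring_scheme \<Rightarrow> ('f, 'a, 'm) module_scheme \<Rightarrow> bool" where
  "has_filtered_multiplicative_basis K A \<longleftrightarrow> (\<exists>B. filtered_multiplicative_basis K A B)"

definition perfect_field :: "'f::field itself \<Rightarrow> bool" where
  "perfect_field _ \<longleftrightarrow> CHAR('f) = 0 \<or> surj (\<lambda>x::'f. x ^ CHAR('f))"


section \<open>The free associative algebra\<close>

text \<open>The free monoid is written additively, because \<^typ>\<open>'m \<Rightarrow>\<^sub>0 'f\<close> is the monoid algebra of
  an additively written monoid \<open>'m\<close>.\<close>

datatype 'x free_monoid = FMon (letters: "'x list")

instantiation free_monoid :: (type) monoid_add
begin

definition "0 = FMon []"

definition "v + w = FMon (letters v @ letters w)"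

instance
  by standard (simp_all add: zero_free_monoid_def plus_free_monoid_def)

end

definition free_algebra :: "('f::field, 'x free_monoid \<Rightarrow>\<^sub>0 'f) module" where
  "free_algebra =
    \<lparr>carrier = UNIV, mult = (*), one = 1, zero = 0, add = (+),
     smult = (\<lambda>c f. Poly_Mapping.single 0 c * f)\<rparr>"

definition free_gen :: "'x \<Rightarrow> 'x free_monoid \<Rightarrow>\<^sub>0 'f::field" where
  "free_gen x = Poly_Mapping.single (FMon [x]) 1"

lemma assoc_algebra_free_algebra:
  "assoc_algebra class_ring (free_algebra :: ('f::field, 'x free_monoid \<Rightarrow>\<^sub>0 'f) module)"
proof -
  let ?A = "free_algebra :: ('f, 'x free_monoid \<Rightarrow>\<^sub>0 'f) module"
  have ab: "abelian_group ?A"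
    by (rule abelian_groupI)
      (auto simp: free_algebra_def add.assoc add.commute intro: exI[of _ "- x" for x])
  have "Group.monoid ?A"
    by (rule Group.monoidI) (auto simp: free_algebra_def mult.assoc)
  then have ring: "ring ?A"
    using ab by (intro ringI) (auto simp: free_algebra_def algebra_simps)
  have comm: "x * (Poly_Mapping.single 0 c * y) = Poly_Mapping.single 0 c * (x * y)"
    for c and x y :: "'x free_monoid \<Rightarrow>\<^sub>0 'f"
  proof -
    have "x * Poly_Mapping.single 0 c = Poly_Mapping.single 0 c * x"
      proof (induction x rule: update_induct)
        case (update g a b)
        have "Poly_Mapping.update a b g = Poly_Mapping.single a b + g"
          using update(1) by (intro poly_mapping_eqI)
            (auto simp: lookup_update lookup_add lookup_single in_keys_iff when_def)
        then show ?case using update by (simp add: mult_single algebra_simps)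
      qed simp
    then show ?thesis by (simp add: mult.assoc[symmetric])
  qed
  have "vectorspace class_ring ?A"
    by (intro vectorspace.intro moduleI ab domain.axioms(1) field.axioms(1) class_field.field_axioms)
      (auto simp: free_algebra_def distrib_left distrib_right single_add mult_single mult.assoc[symmetric])
  then show ?thesis
    by (intro assoc_algebra.intro assoc_algebra_axioms.intro ring)
      (auto simp: free_algebra_def comm mult.assoc)
qed


section \<open>Lie algebras and restricted Lie algebras\<close>

locale lie_algebra = vector_space scale
  for scale :: "'f::field \<Rightarrow> 'l::ab_group_add \<Rightarrow> 'l" +
  fixes bracket :: "'l \<Rightarrow> 'l \<Rightarrow> 'l"
  assumes bracket_add_left: "bracket (x + y) z = bracket x z + bracket y z"
    and bracket_add_right: "bracket x (y + z) = bracket x y + bracket x z"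
    and bracket_scale_left: "bracket (scale c x) y = scale c (bracket x y)"
    and bracket_scale_right: "bracket x (scale c y) = scale c (bracket x y)"
    and bracket_self: "bracket x x = 0"
    and jacobi: "bracket x (bracket y z) + bracket y (bracket z x) + bracket z (bracket x y) = 0"
begin

definition abelian :: bool where
  "abelian \<longleftrightarrow> (\<forall>x y. bracket x y = 0)"

definition finite_dimensional :: bool where
  "finite_dimensional \<longleftrightarrow> (\<exists>B. finite B \<and> span B = UNIV)"

text \<open>The first two families of relations turn the free algebra on the set \<open>L\<close> into the tensor
  algebra of the vector space \<open>L\<close>.\<close>

definition enveloping_relations :: "('l free_monoid \<Rightarrow>\<^sub>0 'f) set" where
  "enveloping_relations =
    {free_gen (x + y) - (free_gen x + free_gen y) | x y. True} \<union>
    {free_gen (scale c x) - Poly_Mapping.single 0 c * free_gen x | c x. True} \<union>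
    {free_gen x * free_gen y - free_gen y * free_gen x - free_gen (bracket x y) | x y. True}"

definition enveloping_algebra :: "('f, ('l free_monoid \<Rightarrow>\<^sub>0 'f) set) module" where
  "enveloping_algebra = quotient_algebra free_algebra (genideal free_algebra enveloping_relations)"

definition enveloping_inj :: "'l \<Rightarrow> ('l free_monoid \<Rightarrow>\<^sub>0 'f) set" where
  "enveloping_inj x =
    genideal free_algebra enveloping_relations +>\<^bsub>free_algebra\<^esub> free_gen x"

lemma assoc_algebra_enveloping_algebra: "assoc_algebra class_ring enveloping_algebra"
proof -
  interpret F: assoc_algebra class_ring "free_algebra :: ('f, 'l free_monoid \<Rightarrow>\<^sub>0 'f) module"
    by (rule assoc_algebra_free_algebra)
  show ?thesis unfolding enveloping_algebra_def
    by (intro F.assoc_algebra_quotient F.A.genideal_ideal) (auto simp: free_algebra_def)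
qed

lemma enveloping_inj_closed: "enveloping_inj x \<in> carrier enveloping_algebra"
proof -
  interpret F: assoc_algebra class_ring "free_algebra :: ('f, 'l free_monoid \<Rightarrow>\<^sub>0 'f) module"
    by (rule assoc_algebra_free_algebra)
  have "carrier (free_algebra :: ('f, 'l free_monoid \<Rightarrow>\<^sub>0 'f) module) = UNIV"
    by (simp add: free_algebra_def)
  then show ?thesis unfolding enveloping_algebra_def enveloping_inj_def
    by (auto simp: quotient_algebra_def FactRing_def intro!: F.a_rcosetsI)
qed

text \<open>The operator \<open>ad (t x + y)\<close> on \<open>L[t]\<close>, whose elements are represented by polynomials
  with coefficients in \<open>L\<close>.\<close>

definition ad_tx_plus :: "'l \<Rightarrow> 'l \<Rightarrow> 'l poly \<Rightarrow> 'l poly" where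
  "ad_tx_plus x y v = pCons 0 (map_poly (bracket x) v) + map_poly (bracket y) v"

text \<open>Jacobson's \<open>s\<^sub>i(x, y)\<close> in characteristic \<open>p\<close>, for \<open>0 < i < p\<close>: the element \<open>i s\<^sub>i(x, y)\<close>
  is the coefficient of \<open>t\<^bsup>i - 1\<^esup>\<close> in \<open>(ad (t x + y))\<^bsup>p - 1\<^esup>(x)\<close>.\<close>

definition jacobson_s :: "nat \<Rightarrow> nat \<Rightarrow> 'l \<Rightarrow> 'l \<Rightarrow> 'l" where
  "jacobson_s p i x y =
    scale (inverse (of_nat i)) (coeff ((ad_tx_plus x y ^^ (p - 1)) [:x:]) (i - 1))"

end

locale restricted_lie_algebra = lie_algebra scale bracket
  for scale :: "'f::field \<Rightarrow> 'l::ab_group_add \<Rightarrow> 'l" and bracket :: "'l \<Rightarrow> 'l \<Rightarrow> 'l" +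
  fixes p :: nat and pmap :: "'l \<Rightarrow> 'l"
  assumes p_pos: "p > 0"
    and char_p: "CHAR('f) = p"
    and pmap_scale: "pmap (scale c x) = scale (c ^ p) (pmap x)"
    and bracket_pmap: "bracket (pmap x) y = (bracket x ^^ p) y"
    and pmap_add: "pmap (x + y) = pmap x + pmap y + (\<Sum>i\<in>{1..<p}. jacobson_s p i x y)"
begin

definition p_nilpotent :: bool where
  "p_nilpotent \<longleftrightarrow> (\<forall>x. \<exists>n\<ge>1. (pmap ^^ n) x = 0)"

definition restricted_enveloping_algebra ::
    "('f, ('l free_monoid \<Rightarrow>\<^sub>0 'f) set set) module" where
  "restricted_enveloping_algebra = quotient_algebra enveloping_algebra
    (genideal enveloping_algebra
      {(enveloping_inj x [^]\<^bsub>enveloping_algebra\<^esub> p) \<ominus>\<^bsub>enveloping_algebra\<^esub>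
         enveloping_inj (pmap x) | x. True})"

lemma assoc_algebra_restricted_enveloping_algebra:
  "assoc_algebra class_ring restricted_enveloping_algebra"
proof -
  interpret U: assoc_algebra class_ring enveloping_algebra
    by (rule assoc_algebra_enveloping_algebra)
  show ?thesis unfolding restricted_enveloping_algebra_def
    by (intro U.assoc_algebra_quotient U.A.genideal_ideal) (auto simp: enveloping_inj_closed)
qed

definition restricted_subalgebra :: "'l set \<Rightarrow> bool" where
  "restricted_subalgebra S \<longleftrightarrow>
    subspace S \<and> (\<forall>x\<in>S. \<forall>y\<in>S. bracket x y \<in> S) \<and> (\<forall>x\<in>S. pmap x \<in> S)"

definition cyclic_restricted_subalgebra :: "'l set \<Rightarrow> bool" where
  "cyclic_restricted_subalgebra S \<longleftrightarrow> (\<exists>x. S = restricted_subalgebra hull {x})"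

text \<open>Decomposition of \<open>L\<close> as the internal direct sum of finitely many restricted subalgebras.
  For a direct sum of Lie algebras, distinct summands have to commute.\<close>

definition direct_sum_of :: "'i set \<Rightarrow> ('i \<Rightarrow> 'l set) \<Rightarrow> bool" where
  "direct_sum_of I S \<longleftrightarrow>
    finite I \<and>
    (\<forall>i\<in>I. restricted_subalgebra (S i)) \<and>
    (\<forall>i\<in>I. \<forall>j\<in>I. i \<noteq> j \<longrightarrow> (\<forall>x\<in>S i. \<forall>y\<in>S j. bracket x y = 0)) \<and>
    (\<forall>x. \<exists>!f. f \<in> Pi\<^sub>E I S \<and> x = sum f I)"

definition decomposes_into_cyclics :: bool where
  "decomposes_into_cyclics \<longleftrightarrow>
    (\<exists>(I :: nat set) S. direct_sum_of I S \<and> (\<forall>i\<in>I. cyclic_restricted_subalgebra (S i)))"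

end

end

theory Submission
  imports Defs "HOL-Computational_Algebra.Primes"
begin

text \<open>
  Write \<open>t\<close> for the \<open>p\<close>-map of the abelian algebra \<open>L\<close>; it is additive and \<open>p\<close>-semilinear.
  Using \<open>p\<close>-nilpotency, \<open>L\<close> is a direct sum of cyclic subalgebras iff it has a basis consisting
  of Jordan chains of \<open>t\<close>, and this holds iff relations lift: whenever \<open>t\<^sup>k x\<close> lies in the span of
  \<open>t\<^sup>k Y\<close>, it already lies in \<open>t\<^sup>k (span Y)\<close>. Over a perfect field this is automatic.

  A multiplicative basis \<open>B\<close> of \<open>u(L)\<close> is mapped to \<open>B \<union> {0}\<close> by the \<open>p\<^sup>k\<close>-th power, so in
  coordinates with respect to \<open>B\<close> that power is a linear map followed by the coordinatewise Frobenius
  map. Since the Frobenius map preserves linear independence, relations lift in \<open>u(L)\<close>, and hence in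
  \<open>L\<close>, which embeds into \<open>u(L)\<close>. Conversely, if \<open>L\<close> has a basis of Jordan chains with heads \<open>h\<^sub>i\<close> of
  length \<open>e\<^sub>i\<close>, then \<open>u(L)\<close> is the truncated polynomial algebra in the \<open>h\<^sub>i\<close> with relations
  \<open>h\<^sub>i\<close> to the power \<open>p\<close> to the \<open>e\<^sub>i\<close> equal to \<open>0\<close>, and the monomials form a filtered multiplicative basis.
\<close>

section \<open>Evaluation of polynomial mappings and quotient algebras\<close>

text \<open>Over an imperfect field the image of a subspace under a power of \<open>t\<close> is in
  general closed only under scalars that are suitable \<open>p\<close>-powers, so the usual
  construction of Jordan chains can break down; lifting of relations repairs its one critical step.
  No Poincare-Birkhoff-Witt theorem is invoked. Since L is abelian, u(L) is a quotient of the
  commutative polynomial ring on the set L, and nonvanishing in u(L) is detected by test maps: a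
  linear map from L into a commutative algebra that turns \<open>t\<close> into the
  \<open>p\<close>-th power modulo an ideal extends to u(L). Two such maps are used. One goes to
  F[Y]/(Y^(p^n)), with F acting through a power of Frobenius, and shows that L embeds before any
  chain basis is known. The other goes to the truncated polynomial algebra, is available once chains
  exist, and shows that the monomials are independent.\<close>

lemma poly_mapping_add_induct [case_names single add]:
  fixes f :: "'m \<Rightarrow>\<^sub>0 'r::monoid_add"
  assumes single: "\<And>m c. P (Poly_Mapping.single m c)"
    and add: "\<And>f g. P f \<Longrightarrow> P g \<Longrightarrow> P (f + g)"
  shows "P f"
proof (induction f rule: update_induct)
  case const
  show ?case using single[of undefined 0] by simp
next
  case (update g a b)
  have "Poly_Mapping.update a b g = Poly_Mapping.single a b + g"
    using update(1) by (intro poly_mapping_eqI)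
      (auto simp: lookup_update lookup_add lookup_single in_keys_iff when_def)
  then show ?case using add[OF single update(3), of a b] by simp
qed

text \<open>The coefficient map \<open>\<phi>\<close> is kept separate because it is not always the
  inclusion of constants: embedding L into u(L) needs a twist by a power of Frobenius.\<close>

definition poly_mapping_eval ::
    "('f::zero \<Rightarrow> 'r) \<Rightarrow> ('m \<Rightarrow> 'r) \<Rightarrow> ('m \<Rightarrow>\<^sub>0 'f) \<Rightarrow> 'r::semiring_0" where
  "poly_mapping_eval \<phi> \<psi> f = (\<Sum>m\<in>Poly_Mapping.keys f. \<phi> (Poly_Mapping.lookup f m) * \<psi> m)"

context
  fixes \<phi> :: "'f::ring_1 \<Rightarrow> 'r::ring_1"
  assumes add: "\<And>a b. \<phi> (a + b) = \<phi> a + \<phi> b"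
begin

private lemma zero: "\<phi> 0 = 0"
  using add[of 0 0] by simp

lemma poly_mapping_eval_superset:
  assumes "finite A" "Poly_Mapping.keys f \<subseteq> A"
  shows "poly_mapping_eval \<phi> \<psi> f = (\<Sum>m\<in>A. \<phi> (Poly_Mapping.lookup f m) * \<psi> m)"
  unfolding poly_mapping_eval_def
  by (rule sum.mono_neutral_left) (use assms in \<open>auto simp: in_keys_iff zero\<close>)

lemma poly_mapping_eval_zero: "poly_mapping_eval \<phi> \<psi> 0 = 0"
  by (simp add: poly_mapping_eval_def)

lemma poly_mapping_eval_single:
  "poly_mapping_eval \<phi> \<psi> (Poly_Mapping.single m c) = \<phi> c * \<psi> m"
  by (subst poly_mapping_eval_superset[of "{m}"]) auto

lemma poly_mapping_eval_add:
  "poly_mapping_eval \<phi> \<psi> (f + g) = poly_mapping_eval \<phi> \<psi> f + poly_mapping_eval \<phi> \<psi> g"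
proof -
  let ?A = "Poly_Mapping.keys f \<union> Poly_Mapping.keys g"
  have "Poly_Mapping.keys (f + g) \<subseteq> ?A" by (rule keys_add)
  then show ?thesis
    by (simp add: poly_mapping_eval_superset[of ?A] lookup_add add distrib_right sum.distrib)
qed

lemma poly_mapping_eval_uminus:
  "poly_mapping_eval \<phi> \<psi> (- f) = - poly_mapping_eval \<phi> \<psi> f"
proof (rule minus_unique[symmetric])
  show "poly_mapping_eval \<phi> \<psi> f + poly_mapping_eval \<phi> \<psi> (- f) = 0"
    unfolding poly_mapping_eval_add[symmetric] by (simp add: poly_mapping_eval_zero)
qed

lemma poly_mapping_eval_diff:
  "poly_mapping_eval \<phi> \<psi> (f - g) = poly_mapping_eval \<phi> \<psi> f - poly_mapping_eval \<phi> \<psi> g"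
  using poly_mapping_eval_add[of \<psi> f "- g"] by (simp add: poly_mapping_eval_uminus)

lemma poly_mapping_eval_sum:
  "poly_mapping_eval \<phi> \<psi> (sum f A) = (\<Sum>i\<in>A. poly_mapping_eval \<phi> \<psi> (f i))"
  by (induction A rule: infinite_finite_induct)
    (simp_all add: poly_mapping_eval_zero poly_mapping_eval_add)

end

context
  fixes \<phi> :: "'f::ring_1 \<Rightarrow> 'r::comm_ring_1" and \<psi> :: "'m::monoid_add \<Rightarrow> 'r"
  assumes hom: "\<And>a b. \<phi> (a + b) = \<phi> a + \<phi> b" "\<And>a b. \<phi> (a * b) = \<phi> a * \<phi> b" "\<phi> 1 = 1"
    and mon: "\<And>a b. \<psi> (a + b) = \<psi> a * \<psi> b" "\<psi> 0 = 1"
begin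

lemma poly_mapping_eval_mult:
  "poly_mapping_eval \<phi> \<psi> (f * g) = poly_mapping_eval \<phi> \<psi> f * poly_mapping_eval \<phi> \<psi> g"
proof (induction f rule: poly_mapping_add_induct)
  case (single m c)
  then show ?case
  proof (induction g rule: poly_mapping_add_induct)
    case (single n d)
    then show ?case
      by (simp add: mult_single poly_mapping_eval_single hom mon algebra_simps)
  qed (simp add: distrib_left poly_mapping_eval_add hom)
qed (simp add: distrib_right poly_mapping_eval_add hom)

lemma poly_mapping_eval_one: "poly_mapping_eval \<phi> \<psi> 1 = 1"
  using poly_mapping_eval_single[of \<phi> \<psi> 0 1] by (simp add: hom mon)

lemma poly_mapping_eval_power:
  "poly_mapping_eval \<phi> \<psi> (f ^ n) = poly_mapping_eval \<phi> \<psi> f ^ n"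
  by (induction n) (simp_all add: poly_mapping_eval_one poly_mapping_eval_mult)

end

lemma single_power:
  "Poly_Mapping.single m c ^ n = Poly_Mapping.single (\<Sum>i<n. m) (c ^ n)"
  for m :: "'m::comm_monoid_add" and c :: "'f::comm_semiring_1"
  by (induction n) (simp_all add: mult_single add.commute)

lemma CHAR_poly_mapping: "CHAR('m::monoid_add \<Rightarrow>\<^sub>0 'f::semiring_1) = CHAR('f)"
proof (rule CHAR_eqI)
  have of_nat: "(of_nat n :: 'm \<Rightarrow>\<^sub>0 'f) = Poly_Mapping.single 0 (of_nat n)" for n
    by simp
  show "(of_nat CHAR('f) :: 'm \<Rightarrow>\<^sub>0 'f) = 0" by (simp add: of_nat del: single_of_nat)
  show "CHAR('f) dvd n" if "(of_nat n :: 'm \<Rightarrow>\<^sub>0 'f) = 0" for n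
    using that unfolding of_nat
    by (metis lookup_single_eq lookup_zero of_nat_eq_0_iff_char_dvd)
qed

section \<open>Quotient algebras in terms of coset representatives\<close>

context assoc_algebra
begin

context
  fixes J
  assumes J: "ideal J A"
begin

interpretation J: ideal J A by (rule J)

lemma carrier_quotient_algebra: "carrier (quotient_algebra A J) = (\<lambda>x. J +> x) ` carrier A"
  by (auto simp: quotient_algebra_def FactRing_simps)

lemma quotient_algebra_zero: "\<zero>\<^bsub>quotient_algebra A J\<^esub> = J"
  by (simp add: quotient_algebra_def FactRing_def)

lemma quotient_algebra_one: "\<one>\<^bsub>quotient_algebra A J\<^esub> = J +> \<one>"
  by (simp add: quotient_algebra_def FactRing_def)

lemma quotient_algebra_add:
  "x \<in> carrier A \<Longrightarrow> y \<in> carrier A \<Longrightarrow>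
    (J +> x) \<oplus>\<^bsub>quotient_algebra A J\<^esub> (J +> y) = J +> (x \<oplus> y)"
  by (simp add: quotient_algebra_def FactRing_def J.a_rcos_sum)

lemma quotient_algebra_mult:
  "x \<in> carrier A \<Longrightarrow> y \<in> carrier A \<Longrightarrow>
    (J +> x) \<otimes>\<^bsub>quotient_algebra A J\<^esub> (J +> y) = J +> (x \<otimes> y)"
  by (simp add: quotient_algebra_def FactRing_def J.rcoset_mult_add)

lemma quotient_algebra_smult:
  "c \<in> carrier K \<Longrightarrow> x \<in> carrier A \<Longrightarrow>
    c \<odot>\<^bsub>quotient_algebra A J\<^esub> (J +> x) = J +> (c \<odot> x)"
  using smult_coset[OF J] by (simp add: quotient_algebra_def)

lemma quotient_algebra_coset_eq_zero:
  "x \<in> carrier A \<Longrightarrow> J +> x = \<zero>\<^bsub>quotient_algebra A J\<^esub> \<longleftrightarrow> x \<in> J"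
  using J.a_rcos_self J.a_rcos_const by (auto simp: quotient_algebra_zero)

end

end

lemma free_algebra_simps [simp]:
  "carrier free_algebra = UNIV" "mult free_algebra = (*)" "\<one>\<^bsub>free_algebra\<^esub> = 1"
  "\<zero>\<^bsub>free_algebra\<^esub> = 0" "add free_algebra = (+)"
  "c \<odot>\<^bsub>free_algebra\<^esub> f = Poly_Mapping.single 0 c * f"
  by (simp_all add: free_algebra_def)

interpretation free_algebra: assoc_algebra class_ring
  "free_algebra :: ('f::field, 'x free_monoid \<Rightarrow>\<^sub>0 'f) module"
  by (rule assoc_algebra_free_algebra)

text \<open>Closure under negation comes from multiplication by \<open>- 1\<close>.\<close>

lemma ideal_free_algebra:
  fixes I :: "('x free_monoid \<Rightarrow>\<^sub>0 'f::field) set"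
  shows "ideal I free_algebra \<longleftrightarrow>
    0 \<in> I \<and> (\<forall>f\<in>I. \<forall>g\<in>I. f + g \<in> I) \<and> (\<forall>f\<in>I. \<forall>g. g * f \<in> I \<and> f * g \<in> I)"
    (is "_ \<longleftrightarrow> ?R")
proof
  assume "ideal I free_algebra"
  then interpret I: ideal I free_algebra .
  show ?R using I.zero_closed I.a_closed I.I_l_closed I.I_r_closed by auto
next
  assume R: ?R
  have neg: "- f \<in> I" if "f \<in> I" for f
    using R[THEN conjunct2, THEN conjunct2, rule_format, OF that, of "- 1"] by simp
  have ainv: "\<ominus>\<^bsub>free_algebra\<^esub> f = - f" for f :: "'x free_monoid \<Rightarrow>\<^sub>0 'f"
    by (rule free_algebra.module.M.minus_equality) auto
  show "ideal I (free_algebra :: ('f, 'x free_monoid \<Rightarrow>\<^sub>0 'f) module)"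
  proof (rule idealI)
    show "ring (free_algebra :: ('f, 'x free_monoid \<Rightarrow>\<^sub>0 'f) module)"
      by (rule free_algebra.A.ring_axioms)
    show "subgroup I (add_monoid (free_algebra :: ('f, 'x free_monoid \<Rightarrow>\<^sub>0 'f) module))"
      using R neg by (intro free_algebra.module.M.add.subgroupI) (auto simp: ainv simp flip: a_inv_def)
  qed (use R in auto)
qed

section \<open>The restricted enveloping algebra as a quotient of a polynomial ring\<close>

context restricted_lie_algebra
begin

lemma ideal_enveloping_relations:
  "ideal (genideal free_algebra enveloping_relations) free_algebra"
  by (rule free_algebra.A.genideal_ideal) simp

definition enveloping_proj :: "('l free_monoid \<Rightarrow>\<^sub>0 'f) \<Rightarrow> ('l free_monoid \<Rightarrow>\<^sub>0 'f) set" where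
  "enveloping_proj f = genideal free_algebra enveloping_relations +>\<^bsub>free_algebra\<^esub> f"

definition p_relations :: "('l free_monoid \<Rightarrow>\<^sub>0 'f) set set" where
  "p_relations = {(enveloping_inj x [^]\<^bsub>enveloping_algebra\<^esub> p) \<ominus>\<^bsub>enveloping_algebra\<^esub>
         enveloping_inj (pmap x) | x. True}"

text \<open>Composite of the two quotient maps. Elements of u(L) are handled through representatives
  in the free algebra, where arithmetic belongs to a type class.\<close>

definition proj :: "('l free_monoid \<Rightarrow>\<^sub>0 'f) \<Rightarrow> ('l free_monoid \<Rightarrow>\<^sub>0 'f) set set" where
  "proj f = genideal enveloping_algebra p_relations +>\<^bsub>enveloping_algebra\<^esub> enveloping_proj f"

interpretation U: assoc_algebra class_ring enveloping_algebra
  by (rule assoc_algebra_enveloping_algebra)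

interpretation A: assoc_algebra class_ring restricted_enveloping_algebra
  by (rule assoc_algebra_restricted_enveloping_algebra)

lemma carrier_enveloping_algebra: "carrier enveloping_algebra = range enveloping_proj"
  using free_algebra.carrier_quotient_algebra[OF ideal_enveloping_relations]
  by (auto simp: enveloping_algebra_def enveloping_proj_def)

lemma enveloping_proj_closed [simp]: "enveloping_proj f \<in> carrier enveloping_algebra"
  by (auto simp: carrier_enveloping_algebra)

lemma enveloping_proj_add:
  "enveloping_proj (f + g) = enveloping_proj f \<oplus>\<^bsub>enveloping_algebra\<^esub> enveloping_proj g"
  using free_algebra.quotient_algebra_add[OF ideal_enveloping_relations]
  by (simp add: enveloping_algebra_def enveloping_proj_def)

lemma enveloping_proj_mult:
  "enveloping_proj (f * g) = enveloping_proj f \<otimes>\<^bsub>enveloping_algebra\<^esub> enveloping_proj g"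
  using free_algebra.quotient_algebra_mult[OF ideal_enveloping_relations]
  by (simp add: enveloping_algebra_def enveloping_proj_def)

lemma enveloping_proj_one: "enveloping_proj 1 = \<one>\<^bsub>enveloping_algebra\<^esub>"
  using free_algebra.quotient_algebra_one[OF ideal_enveloping_relations]
  by (simp add: enveloping_algebra_def enveloping_proj_def)

lemma enveloping_proj_smult:
  "enveloping_proj (Poly_Mapping.single 0 c * f) = c \<odot>\<^bsub>enveloping_algebra\<^esub> enveloping_proj f"
  using free_algebra.quotient_algebra_smult[OF ideal_enveloping_relations, of c f]
  by (simp add: enveloping_algebra_def enveloping_proj_def)

lemma enveloping_proj_eq_zero:
  "enveloping_proj f = \<zero>\<^bsub>enveloping_algebra\<^esub> \<longleftrightarrow> f \<in> genideal free_algebra enveloping_relations"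
  using free_algebra.quotient_algebra_coset_eq_zero[OF ideal_enveloping_relations, of f]
  by (simp add: enveloping_algebra_def enveloping_proj_def)

lemma enveloping_proj_zero: "enveloping_proj 0 = \<zero>\<^bsub>enveloping_algebra\<^esub>"
  using ideal_enveloping_relations by (simp add: enveloping_proj_eq_zero ideal_free_algebra)

lemma enveloping_proj_uminus: "\<ominus>\<^bsub>enveloping_algebra\<^esub> enveloping_proj f = enveloping_proj (- f)"
  by (rule U.module.M.minus_equality)
    (simp_all add: enveloping_proj_add[symmetric] enveloping_proj_zero)

lemma enveloping_proj_diff:
  "enveloping_proj (f - g) = enveloping_proj f \<ominus>\<^bsub>enveloping_algebra\<^esub> enveloping_proj g"
  by (simp add: a_minus_def enveloping_proj_uminus enveloping_proj_add[symmetric])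

lemma enveloping_proj_power:
  "enveloping_proj (f ^ n) = enveloping_proj f [^]\<^bsub>enveloping_algebra\<^esub> n"
  by (induction n) (simp_all add: enveloping_proj_one enveloping_proj_mult power_commutes[symmetric] power_Suc2 del: power_Suc)

lemma enveloping_inj_eq: "enveloping_inj x = enveloping_proj (free_gen x)"
  by (simp add: enveloping_inj_def enveloping_proj_def)

lemma enveloping_proj_eqI:
  assumes "f - g \<in> enveloping_relations"
  shows "enveloping_proj f = enveloping_proj g"
proof -
  have "f - g \<in> genideal free_algebra enveloping_relations"
    using free_algebra.A.genideal_self[of enveloping_relations] assms by auto
  then have "enveloping_proj (f - g) = \<zero>\<^bsub>enveloping_algebra\<^esub>"
    by (simp add: enveloping_proj_eq_zero)
  then have "enveloping_proj (f - g + g) = enveloping_proj g"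
    unfolding enveloping_proj_add by simp
  then show ?thesis by simp
qed

lemma p_relations_eq:
  "p_relations = {enveloping_proj (free_gen x ^ p - free_gen (pmap x)) | x. True}"
  by (simp add: p_relations_def enveloping_inj_eq enveloping_proj_diff enveloping_proj_power)

lemma ideal_p_relations: "ideal (genideal enveloping_algebra p_relations) enveloping_algebra"
  by (rule U.A.genideal_ideal) (auto simp: p_relations_eq)

lemma restricted_enveloping_algebra_eq:
  "restricted_enveloping_algebra =
    quotient_algebra enveloping_algebra (genideal enveloping_algebra p_relations)"
  by (simp add: restricted_enveloping_algebra_def p_relations_def)

lemma carrier_restricted_enveloping_algebra: "carrier restricted_enveloping_algebra = range proj"
  using U.carrier_quotient_algebra[OF ideal_p_relations]
  by (auto simp: restricted_enveloping_algebra_eq proj_def carrier_enveloping_algebra)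

lemma proj_closed [simp]: "proj f \<in> carrier restricted_enveloping_algebra"
  by (auto simp: carrier_restricted_enveloping_algebra)

lemma proj_add: "proj (f + g) = proj f \<oplus>\<^bsub>restricted_enveloping_algebra\<^esub> proj g"
  using U.quotient_algebra_add[OF ideal_p_relations]
  by (simp add: restricted_enveloping_algebra_eq proj_def enveloping_proj_add)

lemma proj_mult: "proj (f * g) = proj f \<otimes>\<^bsub>restricted_enveloping_algebra\<^esub> proj g"
  using U.quotient_algebra_mult[OF ideal_p_relations]
  by (simp add: restricted_enveloping_algebra_eq proj_def enveloping_proj_mult)

lemma proj_smult:
  "proj (Poly_Mapping.single 0 c * f) = c \<odot>\<^bsub>restricted_enveloping_algebra\<^esub> proj f"
  using U.quotient_algebra_smult[OF ideal_p_relations, of c "enveloping_proj f"]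
  by (simp add: restricted_enveloping_algebra_eq proj_def enveloping_proj_smult)

lemma proj_eq_zero:
  "proj f = \<zero>\<^bsub>restricted_enveloping_algebra\<^esub> \<longleftrightarrow>
    enveloping_proj f \<in> genideal enveloping_algebra p_relations"
  using U.quotient_algebra_coset_eq_zero[OF ideal_p_relations, of "enveloping_proj f"]
  by (simp add: restricted_enveloping_algebra_eq proj_def)

lemma proj_eqI:
  assumes "f - g \<in> enveloping_relations"
  shows "proj f = proj g"
  using enveloping_proj_eqI[OF assms] by (simp add: proj_def)

lemma proj_gen_add: "proj (free_gen (x + y)) = proj (free_gen x + free_gen y)"
  by (rule proj_eqI) (auto simp: enveloping_relations_def)

lemma proj_gen_scale:
  "proj (free_gen (scale c x)) = proj (Poly_Mapping.single 0 c * free_gen x)"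
  by (rule proj_eqI) (auto simp: enveloping_relations_def)

lemma proj_gen_bracket:
  "proj (free_gen x * free_gen y - free_gen y * free_gen x) = proj (free_gen (bracket x y))"
  by (rule proj_eqI) (auto simp: enveloping_relations_def)

lemma proj_gen_pmap: "proj (free_gen (pmap x)) = proj (free_gen x ^ p)"
proof -
  have "p_relations \<subseteq> carrier enveloping_algebra" by (auto simp: p_relations_eq)
  then have "enveloping_proj (free_gen x ^ p - free_gen (pmap x)) \<in> genideal enveloping_algebra p_relations"
    using U.A.genideal_self[of p_relations] unfolding p_relations_eq by blast
  then have "proj (free_gen x ^ p - free_gen (pmap x) + free_gen (pmap x)) = proj (free_gen (pmap x))"
    unfolding proj_add proj_eq_zero[symmetric] by simp
  then show ?thesis by simp
qed

text \<open>Universal property of the two-step quotient: \<open>I\<close> is pushed forward along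
  \<open>enveloping_proj\<close> to an ideal of U(L) containing the \<open>p\<close>-relations. What
  is lost by passing to cosets lies in the ideal generated by the enveloping relations, hence again
  in \<open>I\<close>.\<close>

lemma proj_eq_zero_imp_mem:
  assumes I: "ideal I free_algebra" and rel: "enveloping_relations \<subseteq> I"
    and prel: "\<And>x. free_gen x ^ p - free_gen (pmap x) \<in> I"
    and f: "proj f = \<zero>\<^bsub>restricted_enveloping_algebra\<^esub>"
  shows "f \<in> I"
proof -
  have I': "0 \<in> I" "\<And>f g. f \<in> I \<Longrightarrow> g \<in> I \<Longrightarrow> f + g \<in> I" "\<And>f g. f \<in> I \<Longrightarrow> g * f \<in> I"
    "\<And>f g. f \<in> I \<Longrightarrow> f * g \<in> I"
    using I by (auto simp: ideal_free_algebra)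
  have neg: "- f \<in> I" if "f \<in> I" for f
    using I'(3)[OF that, of "- 1"] by simp
  have "ideal (enveloping_proj ` I) enveloping_algebra"
  proof (rule idealI)
    show "ring enveloping_algebra" by (rule U.A.ring_axioms)
    show "subgroup (enveloping_proj ` I) (add_monoid enveloping_algebra)"
    proof (rule U.module.M.add.subgroupI)
      show "enveloping_proj ` I \<noteq> {}" using I'(1) by auto
      show "\<ominus>\<^bsub>enveloping_algebra\<^esub> a \<in> enveloping_proj ` I" if "a \<in> enveloping_proj ` I" for a
        using that neg by (auto simp: enveloping_proj_uminus)
      show "a \<oplus>\<^bsub>enveloping_algebra\<^esub> b \<in> enveloping_proj ` I"
        if "a \<in> enveloping_proj ` I" "b \<in> enveloping_proj ` I" for a b
        using that I'(2) by (auto simp: enveloping_proj_add[symmetric])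
    qed auto
    fix a x assume "a \<in> enveloping_proj ` I" "x \<in> carrier enveloping_algebra"
    then show "x \<otimes>\<^bsub>enveloping_algebra\<^esub> a \<in> enveloping_proj ` I"
      "a \<otimes>\<^bsub>enveloping_algebra\<^esub> x \<in> enveloping_proj ` I"
      using I'(3,4) by (auto simp: carrier_enveloping_algebra enveloping_proj_mult[symmetric])
  qed
  moreover have "p_relations \<subseteq> enveloping_proj ` I"
    using prel by (auto simp: p_relations_eq)
  ultimately have "genideal enveloping_algebra p_relations \<subseteq> enveloping_proj ` I"
    by (intro U.A.genideal_minimal)
  with f obtain i where i: "i \<in> I" "enveloping_proj f = enveloping_proj i"
    by (auto simp: proj_eq_zero)
  then have "enveloping_proj (f - i) = \<zero>\<^bsub>enveloping_algebra\<^esub>"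
    using U.module.M.r_neg[of "enveloping_proj i"] by (simp add: enveloping_proj_diff a_minus_def)
  then have "f - i \<in> genideal free_algebra enveloping_relations"
    by (simp add: enveloping_proj_eq_zero)
  also have "\<dots> \<subseteq> I" using I rel by (rule free_algebra.A.genideal_minimal)
  finally have "f - i + i \<in> I" using i by (intro I')
  then show ?thesis by simp
qed

end

section \<open>The abelian case: u(L) as a quotient of a commutative polynomial ring\<close>

locale abelian_restricted_lie_algebra = restricted_lie_algebra scale bracket p pmap
  for scale :: "'f::field \<Rightarrow> 'l::ab_group_add \<Rightarrow> 'l" and bracket :: "'l \<Rightarrow> 'l \<Rightarrow> 'l"
    and p :: nat and pmap :: "'l \<Rightarrow> 'l" +
  assumes bracket_eq_zero: "bracket x y = 0"
begin

definition word :: "'l list \<Rightarrow> 'l free_monoid \<Rightarrow>\<^sub>0 'f" where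
  "word xs = Poly_Mapping.single (FMon xs) 1"

lemma word_append: "word (xs @ ys) = word xs * word ys"
  by (simp add: word_def mult_single plus_free_monoid_def)

lemma word_Nil: "word [] = 1"
  by (simp add: word_def zero_free_monoid_def[symmetric] single_one)

lemma word_Cons: "word (x # xs) = free_gen x * word xs"
  using word_append[of "[x]" xs] by (simp add: word_def free_gen_def)

lemma single_eq_word: "Poly_Mapping.single w c = Poly_Mapping.single 0 c * word (letters w)"
  by (simp add: word_def mult_single)

lemma proj_mult_cong: "proj f = proj f' \<Longrightarrow> proj g = proj g' \<Longrightarrow> proj (f * g) = proj (f' * g')"
  by (simp add: proj_mult)

lemma proj_zero: "proj 0 = \<zero>\<^bsub>restricted_enveloping_algebra\<^esub>"
proof -
  interpret A: assoc_algebra class_ring restricted_enveloping_algebra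
    by (rule assoc_algebra_restricted_enveloping_algebra)
  have "proj 0 \<oplus>\<^bsub>restricted_enveloping_algebra\<^esub> proj 0 = proj 0"
    by (simp add: proj_add[symmetric])
  then show ?thesis by (metis A.module.M.add.r_cancel_one proj_closed)
qed

lemma proj_gen_comm: "proj (free_gen x * free_gen y) = proj (free_gen y * free_gen x)"
proof -
  interpret A: assoc_algebra class_ring restricted_enveloping_algebra
    by (rule assoc_algebra_restricted_enveloping_algebra)
  \<comment> \<open>The generator attached to \<open>0\<close> is not zero in the free algebra; the
    scaling relation with \<open>c = 0\<close> kills it.\<close>
  have "proj (free_gen 0) = \<zero>\<^bsub>restricted_enveloping_algebra\<^esub>"
    using proj_gen_scale[of 0 0] by (simp add: proj_zero)
  then have "proj (free_gen x * free_gen y - free_gen y * free_gen x + free_gen y * free_gen x)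
      = proj (free_gen y * free_gen x)"
    by (subst proj_add) (simp add: proj_gen_bracket bracket_eq_zero)
  then show ?thesis by simp
qed

lemma proj_gen_word_comm: "proj (free_gen x * word xs) = proj (word xs * free_gen x)"
proof (induction xs)
  case (Cons y ys)
  have "proj (free_gen x * word (y # ys)) = proj (free_gen x * free_gen y * word ys)"
    by (simp add: word_Cons mult.assoc)
  also have "\<dots> = proj (free_gen y * free_gen x * word ys)"
    by (rule proj_mult_cong[OF proj_gen_comm refl])
  also have "\<dots> = proj (free_gen y * (free_gen x * word ys))"
    by (simp add: mult.assoc)
  also have "\<dots> = proj (free_gen y * (word ys * free_gen x))"
    by (rule proj_mult_cong[OF refl Cons.IH])
  finally show ?case by (simp add: word_Cons mult.assoc)
qed (simp add: word_Nil)

text \<open>Induction on the first word: its first letter is located in \<open>ys\<close> and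
  commuted past the prefix \<open>us\<close>.\<close>

lemma proj_word_perm: "mset xs = mset ys \<Longrightarrow> proj (word xs) = proj (word ys)"
proof (induction xs arbitrary: ys)
  case (Cons x xs)
  then have "x \<in> set ys" by (metis list.set_intros(1) set_mset_mset)
  then obtain us vs where ys: "ys = us @ x # vs" by (auto simp: in_set_conv_decomp)
  have "proj (word (x # xs)) = proj (free_gen x * word (us @ vs))"
    unfolding word_Cons using Cons ys by (intro proj_mult_cong Cons.IH) auto
  also have "\<dots> = proj (free_gen x * word us * word vs)"
    by (simp add: word_append mult.assoc)
  also have "\<dots> = proj (word us * free_gen x * word vs)"
    by (rule proj_mult_cong[OF proj_gen_word_comm refl])
  finally show ?case by (simp add: ys word_append word_Cons mult.assoc)
qed simp

text \<open>Monomials of the commutative polynomial ring on the set L are finite multisets; this is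
  the canonical homomorphism onto it from the free algebra.\<close>

definition abelianize :: "('l free_monoid \<Rightarrow>\<^sub>0 'f) \<Rightarrow> ('l multiset \<Rightarrow>\<^sub>0 'f)" where
  "abelianize =
    poly_mapping_eval (Poly_Mapping.single 0) (\<lambda>w. Poly_Mapping.single (mset (letters w)) 1)"

text \<open>An additive section of \<open>abelianize\<close> that picks an arbitrary order of the
  letters. It need not be multiplicative, but the choice is invisible after \<open>proj\<close>,
  since the generators commute in u(L).\<close>

definition lift_word :: "('l multiset \<Rightarrow>\<^sub>0 'f) \<Rightarrow> ('l free_monoid \<Rightarrow>\<^sub>0 'f)" where
  "lift_word = poly_mapping_eval (Poly_Mapping.single 0) (\<lambda>M. word (SOME xs. mset xs = M))"

lemma mset_some: "mset (SOME xs. mset xs = M) = M"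
  by (rule someI_ex) (rule ex_mset)

lemma abelianize_add: "abelianize (f + g) = abelianize f + abelianize g"
  unfolding abelianize_def by (rule poly_mapping_eval_add) (rule single_add)

lemma abelianize_diff: "abelianize (f - g) = abelianize f - abelianize g"
  unfolding abelianize_def by (rule poly_mapping_eval_diff) (rule single_add)

lemma abelianize_zero: "abelianize 0 = 0"
  using abelianize_diff[of 0 0] by simp

lemma abelianize_single: "abelianize (Poly_Mapping.single w c) = Poly_Mapping.single (mset (letters w)) c"
  unfolding abelianize_def
  by (subst poly_mapping_eval_single) (simp_all add: single_add mult_single)

lemma abelianize_const: "abelianize (Poly_Mapping.single 0 c) = Poly_Mapping.single 0 c"
  by (simp add: abelianize_single zero_free_monoid_def)

lemma abelianize_mult: "abelianize (f * g) = abelianize f * abelianize g"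
  unfolding abelianize_def
  by (rule poly_mapping_eval_mult)
    (simp_all add: single_add mult_single plus_free_monoid_def zero_free_monoid_def)

lemma abelianize_one: "abelianize 1 = 1"
  unfolding single_one[symmetric] abelianize_single by (simp add: zero_free_monoid_def)

lemma abelianize_power: "abelianize (f ^ n) = abelianize f ^ n"
  by (induction n) (simp_all add: abelianize_one abelianize_mult)

lemma lift_word_add: "lift_word (f + g) = lift_word f + lift_word g"
  unfolding lift_word_def by (rule poly_mapping_eval_add) (rule single_add)

lemma lift_word_single:
  "lift_word (Poly_Mapping.single M c) = Poly_Mapping.single 0 c * word (SOME xs. mset xs = M)"
  unfolding lift_word_def by (rule poly_mapping_eval_single) (rule single_add)

lemma abelianize_lift_word: "abelianize (lift_word g) = g"
proof (induction g rule: poly_mapping_add_induct)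
  case (single M c)
  then show ?case
    by (simp add: lift_word_single word_def mult_single abelianize_single mset_some)
qed (simp add: lift_word_add abelianize_add)

lemma proj_lift_word_abelianize: "proj (lift_word (abelianize f)) = proj f"
proof (induction f rule: poly_mapping_add_induct)
  case (single w c)
  have "proj (Poly_Mapping.single 0 c * word (SOME xs. mset xs = mset (letters w))) =
      proj (Poly_Mapping.single 0 c * word (letters w))"
    by (intro proj_mult_cong proj_word_perm refl mset_some)
  then show ?case
    by (simp add: abelianize_single lift_word_single single_eq_word[of w c, symmetric])
qed (simp add: lift_word_add abelianize_add proj_add)

definition comm_proj :: "('l multiset \<Rightarrow>\<^sub>0 'f) \<Rightarrow> ('l free_monoid \<Rightarrow>\<^sub>0 'f) set set" where
  "comm_proj g = proj (lift_word g)"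

definition gen :: "'l \<Rightarrow> 'l multiset \<Rightarrow>\<^sub>0 'f" where
  "gen x = Poly_Mapping.single {#x#} 1"

lemma abelianize_free_gen: "abelianize (free_gen x) = gen x"
  by (simp add: free_gen_def abelianize_single gen_def)

lemma comm_proj_abelianize: "comm_proj (abelianize f) = proj f"
  by (simp add: comm_proj_def proj_lift_word_abelianize)

lemma comm_proj_closed [simp]: "comm_proj g \<in> carrier restricted_enveloping_algebra"
  by (simp add: comm_proj_def)

lemma carrier_eq_range_comm_proj: "carrier restricted_enveloping_algebra = range comm_proj"
proof -
  have "proj f \<in> range comm_proj" for f
    using comm_proj_abelianize[of f, symmetric] by simp
  then show ?thesis
    by (auto simp: carrier_restricted_enveloping_algebra comm_proj_def)
qed

lemma comm_proj_add:
  "comm_proj (f + g) = comm_proj f \<oplus>\<^bsub>restricted_enveloping_algebra\<^esub> comm_proj g"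
  by (simp add: comm_proj_def lift_word_add proj_add)

text \<open>\<open>lift_word (f * g)\<close> and \<open>lift_word f * lift_word g\<close> have the
  same abelianization \<open>f * g\<close>, so they agree after \<open>proj\<close>.\<close>

lemma comm_proj_mult:
  "comm_proj (f * g) = comm_proj f \<otimes>\<^bsub>restricted_enveloping_algebra\<^esub> comm_proj g"
  using comm_proj_abelianize[of "lift_word f * lift_word g"]
  by (simp add: abelianize_mult abelianize_lift_word comm_proj_def proj_mult)

lemma comm_proj_zero: "comm_proj 0 = \<zero>\<^bsub>restricted_enveloping_algebra\<^esub>"
  using comm_proj_abelianize[of 0] by (simp add: abelianize_zero proj_zero)

lemma comm_proj_smult:
  "comm_proj (Poly_Mapping.single 0 c * g) = c \<odot>\<^bsub>restricted_enveloping_algebra\<^esub> comm_proj g"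
  using comm_proj_abelianize[of "Poly_Mapping.single 0 c * lift_word g"]
  by (simp add: abelianize_mult abelianize_lift_word abelianize_const
      comm_proj_def proj_smult)

lemma comm_proj_gen_add: "comm_proj (gen (x + y)) = comm_proj (gen x + gen y)"
  using proj_gen_add[of x y] by (simp add: comm_proj_abelianize[symmetric] abelianize_add abelianize_free_gen)

lemma comm_proj_gen_scale: "comm_proj (gen (scale c x)) = comm_proj (Poly_Mapping.single 0 c * gen x)"
  using proj_gen_scale[of c x]
  by (simp add: comm_proj_abelianize[symmetric] abelianize_mult abelianize_free_gen
      abelianize_const)

lemma comm_proj_gen_pmap: "comm_proj (gen (pmap x)) = comm_proj (gen x ^ p)"
  using proj_gen_pmap[of x]
  by (simp add: comm_proj_abelianize[symmetric] abelianize_power abelianize_free_gen)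

text \<open>The test for nonvanishing in u(L): modulo \<open>I\<close>, the map
  \<open>\<theta>\<close> is linear along \<open>\<phi>\<close> and turns the \<open>p\<close>-map
  into the \<open>p\<close>-th power, so evaluation of polynomials at \<open>\<theta>\<close>
  factors through u(L). A polynomial with value outside \<open>I\<close> is therefore nonzero in
  u(L).\<close>

lemma comm_proj_eq_zero_imp_mem:
  fixes \<phi> :: "'f \<Rightarrow> 'r::comm_ring_1" and \<theta> :: "'l \<Rightarrow> 'r"
  assumes hom: "\<And>a b. \<phi> (a + b) = \<phi> a + \<phi> b" "\<And>a b. \<phi> (a * b) = \<phi> a * \<phi> b" "\<phi> 1 = 1"
    and I: "\<And>a b. a \<in> I \<Longrightarrow> b \<in> I \<Longrightarrow> a + b \<in> I" "\<And>a b. a \<in> I \<Longrightarrow> b * a \<in> I"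
    and add: "\<And>x y. \<theta> (x + y) - (\<theta> x + \<theta> y) \<in> I"
    and scale: "\<And>c x. \<theta> (scale c x) - \<phi> c * \<theta> x \<in> I"
    and pow: "\<And>x. \<theta> x ^ p - \<theta> (pmap x) \<in> I"
    and g: "comm_proj g = \<zero>\<^bsub>restricted_enveloping_algebra\<^esub>"
  shows "poly_mapping_eval \<phi> (\<lambda>M. \<Prod>x\<in>#M. \<theta> x) g \<in> I"
proof -
  let ?ev = "poly_mapping_eval \<phi> (\<lambda>M. \<Prod>x\<in>#M. \<theta> x)"
  have ev_add: "?ev (f + g) = ?ev f + ?ev g" for f g
    by (rule poly_mapping_eval_add) (rule hom)
  have ev_diff: "?ev (f - g) = ?ev f - ?ev g" for f g
    by (rule poly_mapping_eval_diff) (rule hom)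
  have ev_uminus: "?ev (- f) = - ?ev f" for f
    by (rule poly_mapping_eval_uminus) (rule hom)
  have ev_mult: "?ev (f * g) = ?ev f * ?ev g" for f g
    by (rule poly_mapping_eval_mult) (simp_all add: hom)
  have ev_power: "?ev (f ^ n) = ?ev f ^ n" for f n
    by (rule poly_mapping_eval_power) (simp_all add: hom)
  have ev_single: "?ev (Poly_Mapping.single M c) = \<phi> c * (\<Prod>x\<in>#M. \<theta> x)" for M c
    by (rule poly_mapping_eval_single) (rule hom)
  have ev_gen: "?ev (gen x) = \<theta> x" for x
    by (simp add: gen_def ev_single hom)
  have zero: "0 \<in> I" using I(2)[OF add[of 0 0], of 0] by simp
  \<comment> \<open>The bracket relation evaluates to \<open>- \<theta> 0\<close>, because the
    bracket vanishes and the target ring is commutative.\<close>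
  have theta0: "- \<theta> 0 \<in> I" using add[of 0 0] by simp
  then have theta0': "\<theta> 0 \<in> I" using I(2)[OF theta0, of "- 1"] by simp
  have I': "a * b \<in> I" if "a \<in> I" for a b
    using I(2)[OF that, of b] by (simp add: mult.commute)
  let ?I = "{f. ?ev (abelianize f) \<in> I}"
  have "lift_word g \<in> ?I"
  proof (rule proj_eq_zero_imp_mem)
    show "ideal ?I free_algebra"
      unfolding ideal_free_algebra
      using zero I I' ev_diff[of 0 0]
      by (simp add: abelianize_add abelianize_mult abelianize_zero ev_add ev_mult)
    show "enveloping_relations \<subseteq> ?I"
      using add scale theta0
      by (auto simp: enveloping_relations_def abelianize_diff abelianize_add abelianize_mult
          abelianize_free_gen abelianize_const ev_diff ev_uminus ev_add ev_mult ev_gen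
          ev_single bracket_eq_zero mult.commute)
    show "free_gen x ^ p - free_gen (pmap x) \<in> ?I" for x
      using pow by (simp add: abelianize_diff abelianize_power abelianize_free_gen ev_diff ev_power ev_gen)
    show "proj (lift_word g) = \<zero>\<^bsub>restricted_enveloping_algebra\<^esub>"
      using g by (simp add: comm_proj_def)
  qed
  then show ?thesis by (simp add: abelianize_lift_word)
qed

end

section \<open>Semilinear algebra of the p-map\<close>

text \<open>Frobenius is a field embedding, and a linear system over its image that is solvable in
  the larger field is already solvable over the image. Here this is Gaussian elimination by
  induction on \<open>Y\<close>.\<close>

lemma frobenius_linear_combination:
  fixes g :: "'n \<Rightarrow> 'f::field" and \<gamma> :: "'y \<Rightarrow> 'n \<Rightarrow> 'f"
  assumes prime: "prime CHAR('f)" and q: "q = CHAR('f) ^ k" and "finite Y"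
    and "\<And>n. n \<in> N \<Longrightarrow> g n ^ q = (\<Sum>y\<in>Y. d y * \<gamma> y n ^ q)"
  shows "\<exists>d'. \<forall>n\<in>N. g n = (\<Sum>y\<in>Y. d' y * \<gamma> y n)"
  using assms(3,4)
proof (induction Y arbitrary: g \<gamma> rule: finite_induct)
  case empty
  have "q > 0" using prime by (simp add: q prime_gt_0_nat)
  then show ?case using empty by auto
next
  case (insert z Y)
  have diff: "(a - b) ^ q = a ^ q - b ^ q" for a b :: 'f
    using freshmans_dream'[OF prime q, of "a - b" b] by simp
  show ?case
  proof (cases "\<exists>m\<in>N. \<gamma> z m \<noteq> 0")
    case False
    have "q > 0" using prime by (simp add: q prime_gt_0_nat)
    then have "g n ^ q = (\<Sum>y\<in>Y. d y * \<gamma> y n ^ q)" if "n \<in> N" for n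
      using insert.prems[OF that] insert.hyps that False by simp
    from insert.IH[of g \<gamma>, OF this] obtain d' where "\<forall>n\<in>N. g n = (\<Sum>y\<in>Y. d' y * \<gamma> y n)" by blast
    then show ?thesis using False insert.hyps by (intro exI[of _ d']) auto
  next
    case True
    then obtain m where m: "m \<in> N" "\<gamma> z m \<noteq> 0" by blast
    \<comment> \<open>With pivot \<open>\<gamma> z m\<close>, subtracting the multiples
      \<open>s\<close> and \<open>r y\<close> of \<open>\<gamma> z\<close> makes coordinate
      \<open>m\<close> vanish everywhere. The equation at \<open>m\<close> determines
      \<open>s ^ q\<close>, which is what makes the term of \<open>z\<close> drop out of the
      remaining system.\<close>
    define r where "r y = \<gamma> y m / \<gamma> z m" for y
    define s where "s = g m / \<gamma> z m"
    have s: "s ^ q = d z + (\<Sum>y\<in>Y. d y * r y ^ q)"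
      using insert.prems[OF m(1)] insert.hyps m(2)
      by (simp add: s_def r_def power_divide add_divide_distrib sum_divide_distrib)
    have "(g n - s * \<gamma> z n) ^ q = (\<Sum>y\<in>Y. d y * (\<gamma> y n - r y * \<gamma> z n) ^ q)" if "n \<in> N" for n
    proof -
      have "(g n - s * \<gamma> z n) ^ q =
          d z * \<gamma> z n ^ q + (\<Sum>y\<in>Y. d y * \<gamma> y n ^ q)
            - (d z + (\<Sum>y\<in>Y. d y * r y ^ q)) * \<gamma> z n ^ q"
        using insert.prems[OF that] insert.hyps by (simp add: diff power_mult_distrib s)
      also have "\<dots> = (\<Sum>y\<in>Y. d y * \<gamma> y n ^ q - d y * r y ^ q * \<gamma> z n ^ q)"
        by (simp add: distrib_right sum_subtractf sum_distrib_right)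
      finally show ?thesis by (simp add: diff power_mult_distrib right_diff_distrib mult.assoc)
    qed
    from insert.IH[of "\<lambda>n. g n - s * \<gamma> z n" "\<lambda>y n. \<gamma> y n - r y * \<gamma> z n", OF this] obtain d'
      where d': "\<And>n. n \<in> N \<Longrightarrow> g n - s * \<gamma> z n = (\<Sum>y\<in>Y. d' y * (\<gamma> y n - r y * \<gamma> z n))"
      by blast
    \<comment> \<open>Undoing the elimination: the coefficient of \<open>z\<close> absorbs all
      subtracted multiples.\<close>
    let ?d = "\<lambda>y. if y = z then s - (\<Sum>y\<in>Y. d' y * r y) else d' y"
    have "g n = (\<Sum>y\<in>insert z Y. ?d y * \<gamma> y n)" if "n \<in> N" for n
    proof -
      have "(\<Sum>y\<in>Y. ?d y * \<gamma> y n) = (\<Sum>y\<in>Y. d' y * \<gamma> y n)"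
        using insert.hyps by (intro sum.cong) auto
      moreover have "(\<Sum>y\<in>Y. d' y * (\<gamma> y n - r y * \<gamma> z n)) =
          (\<Sum>y\<in>Y. d' y * \<gamma> y n) - (\<Sum>y\<in>Y. d' y * r y) * \<gamma> z n"
        by (simp add: right_diff_distrib sum_subtractf sum_distrib_right mult.assoc)
      ultimately show ?thesis
        using d'[OF that] insert.hyps by (simp add: left_diff_distrib diff_eq_eq algebra_simps)
    qed
    then show ?thesis by (intro exI[of _ ?d] ballI)
  qed
qed

context abelian_restricted_lie_algebra
begin

lemma prime_p: "prime p"
  using prime_CHAR_semidom[where ?'a = 'f] p_pos unfolding char_p by blast

lemma pmap_additive: "pmap (x + y) = pmap x + pmap y"
proof -
  have "ad_tx_plus x y v = 0" for v
  proof -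
    have "map_poly (bracket z) v = 0" for z
      by (rule poly_eqI) (simp add: coeff_map_poly bracket_eq_zero)
    then show ?thesis by (simp add: ad_tx_plus_def)
  qed
  \<comment> \<open>A prime is at least 2, so the zero operator is applied at least once; with
    exponent 0 the polynomial \<open>[:x:]\<close> would survive.\<close>
  moreover obtain n where "p - 1 = Suc n"
    using prime_gt_1_nat[OF prime_p] by (metis Suc_diff_1 zero_less_diff)
  ultimately have "jacobson_s p i x y = 0" for i
    by (simp add: jacobson_s_def)
  then show ?thesis by (simp add: pmap_add)
qed

lemma pmap_zero: "pmap 0 = 0"
  using pmap_additive[of 0 0] by simp

lemma pow_pmap_add: "(pmap ^^ k) (x + y) = (pmap ^^ k) x + (pmap ^^ k) y"
  by (induction k) (simp_all add: pmap_additive)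

lemma pow_pmap_zero: "(pmap ^^ k) 0 = 0"
  by (induction k) (simp_all add: pmap_zero)

lemma pow_pmap_diff: "(pmap ^^ k) (x - y) = (pmap ^^ k) x - (pmap ^^ k) y"
  using pow_pmap_add[of k "x - y" y] by simp

lemma pow_pmap_scale: "(pmap ^^ k) (scale c x) = scale (c ^ (p ^ k)) ((pmap ^^ k) x)"
  by (induction k) (simp_all add: pmap_scale power_mult[symmetric] mult.commute)

lemma pow_pmap_sum: "(pmap ^^ k) (sum f S) = (\<Sum>i\<in>S. (pmap ^^ k) (f i))"
proof (induction S rule: infinite_finite_induct)
  case (insert i S)
  then show ?case by (simp add: pow_pmap_add)
qed (simp_all add: pow_pmap_zero)

lemma pow_pmap_pow_pmap: "(pmap ^^ k) ((pmap ^^ j) x) = (pmap ^^ (k + j)) x"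
  by (simp add: funpow_add)

lemma pow_pmap_eq_zero_mono: "(pmap ^^ j) x = 0 \<Longrightarrow> j \<le> k \<Longrightarrow> (pmap ^^ k) x = 0"
  by (metis le_add_diff_inverse2 pow_pmap_pow_pmap pow_pmap_zero)

lemma subspace_ker_pow_pmap: "subspace {x. (pmap ^^ k) x = 0}"
  by (rule subspaceI) (simp_all add: pow_pmap_zero pow_pmap_add pow_pmap_scale)

lemma uniform_nilpotency:
  assumes "finite_dimensional" "p_nilpotent"
  obtains n where "n \<ge> 1" "\<And>x. (pmap ^^ n) x = 0"
proof -
  from assms(1) obtain B where B: "finite B" "span B = UNIV" by (auto simp: finite_dimensional_def)
  from assms(2) obtain m where m: "\<And>x. m x \<ge> 1" "\<And>x. (pmap ^^ m x) x = 0"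
    unfolding p_nilpotent_def by metis
  \<comment> \<open>The sum bounds every exponent on the spanning set; \<open>Suc\<close> keeps
    \<open>n\<close> positive even if \<open>B\<close> is empty.\<close>
  define n where "n = Suc (sum m B)"
  have "B \<subseteq> {x. (pmap ^^ n) x = 0}"
  proof safe
    fix x assume "x \<in> B"
    then have "m x \<le> n" using B(1) by (simp add: n_def le_SucI member_le_sum)
    then show "(pmap ^^ n) x = 0" using m(2) by (rule pow_pmap_eq_zero_mono[rotated])
  qed
  then have "span B \<subseteq> {x. (pmap ^^ n) x = 0}"
    by (rule span_minimal) (rule subspace_ker_pow_pmap)
  then have "(pmap ^^ n) x = 0" for x using B(2) by blast
  then show ?thesis using that[of n] unfolding n_def by simp
qed

text \<open>Coefficients are indexed by \<open>Y\<close> and not by its image, since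
  \<open>f\<close>, later a power of the \<open>p\<close>-map, need not be injective on
  \<open>Y\<close>.\<close>

lemma in_span_image_finite:
  assumes "finite Y" "x \<in> span (f ` Y)"
  shows "\<exists>d. x = (\<Sum>y\<in>Y. scale (d y) (f y))"
proof -
  let ?W = "{\<Sum>y\<in>Y. scale (d y) (f y) | d. True}"
  have "subspace ?W"
  proof (rule subspaceI)
    show "0 \<in> ?W" by (auto intro!: exI[of _ "\<lambda>_. 0"])
    show "x + y \<in> ?W" if "x \<in> ?W" "y \<in> ?W" for x y
    proof -
      from that obtain d d' where "x = (\<Sum>y\<in>Y. scale (d y) (f y))" "y = (\<Sum>y\<in>Y. scale (d' y) (f y))"
        by blast
      then have "x + y = (\<Sum>y\<in>Y. scale (d y + d' y) (f y))"
        by (simp add: scale_left_distrib sum.distrib)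
      then show ?thesis by (intro CollectI exI[of _ "\<lambda>y. d y + d' y"]) simp
    qed
    show "scale c x \<in> ?W" if "x \<in> ?W" for c x
    proof -
      from that obtain d where "x = (\<Sum>y\<in>Y. scale (d y) (f y))" by blast
      then have "scale c x = (\<Sum>y\<in>Y. scale (c * d y) (f y))"
        by (simp add: scale_sum_right)
      then show ?thesis by (intro CollectI exI[of _ "\<lambda>y. c * d y"]) simp
    qed
  qed
  moreover have "f ` Y \<subseteq> ?W"
  proof
    fix v assume "v \<in> f ` Y"
    then obtain z where z: "z \<in> Y" "v = f z" by blast
    have "(\<Sum>y\<in>Y. scale (if y = z then 1 else 0) (f y)) = (\<Sum>y\<in>Y. if y = z then f y else 0)"
      by (rule sum.cong) auto
    also have "\<dots> = v" using z assms(1) by simp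
    finally show "v \<in> ?W" by (intro CollectI exI[of _ "\<lambda>y. if y = z then 1 else 0"]) simp
  qed
  ultimately have "span (f ` Y) \<subseteq> ?W" by (intro span_minimal)
  then show ?thesis using assms(2) by blast
qed

text \<open>\<open>L\<close> is a module over the twisted polynomial ring \<open>F[t]\<close> with \<open>t c = c\<^sup>p t\<close>.
  The following condition says that linear relations between \<open>p\<^sup>k\<close>-th powers come from linear
  relations modulo the kernel of \<open>t\<^sup>k\<close>; it characterises the direct sums of cyclic modules.\<close>

definition relations_liftable :: bool where
  "relations_liftable \<longleftrightarrow> (\<forall>k x Y. finite Y \<longrightarrow> (pmap ^^ k) x \<in> span ((pmap ^^ k) ` Y) \<longrightarrow>
    (\<exists>y\<in>span Y. (pmap ^^ k) x = (pmap ^^ k) y))"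

lemma perfect_imp_relations_liftable:
  assumes "perfect_field TYPE('f)"
  shows "relations_liftable"
proof -
  have surj: "surj (\<lambda>c::'f. c ^ p)"
    using assms p_pos by (simp add: perfect_field_def char_p)
  have surj_pow: "\<exists>d. c = d ^ (p ^ k)" for c :: 'f and k
  proof (induction k arbitrary: c)
    case (Suc k)
    obtain d where "c = d ^ p" using surj by (metis surjD)
    moreover obtain d' where "d = d' ^ (p ^ k)" using Suc by blast
    ultimately show ?case by (auto simp: power_mult[symmetric] mult.commute)
  qed simp
  have "(pmap ^^ k) x \<in> (pmap ^^ k) ` span Y" if "(pmap ^^ k) x \<in> span ((pmap ^^ k) ` Y)" for k x Y
  proof -
    \<comment> \<open>Perfectness enters here: a scalar that is a \<open>p ^ k\<close>-th power can
      be pulled inside the semilinear map.\<close>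
    have "subspace ((pmap ^^ k) ` span Y)"
    proof (rule subspaceI)
      show "0 \<in> (pmap ^^ k) ` span Y" by (rule image_eqI[where x = 0]) (simp_all add: pow_pmap_zero span_zero)
      show "u + v \<in> (pmap ^^ k) ` span Y" if "u \<in> (pmap ^^ k) ` span Y" "v \<in> (pmap ^^ k) ` span Y" for u v
        using that by (auto simp: pow_pmap_add[symmetric] intro: span_add)
      show "scale c u \<in> (pmap ^^ k) ` span Y" if "u \<in> (pmap ^^ k) ` span Y" for c u
      proof -
        obtain d where "c = d ^ (p ^ k)" using surj_pow by blast
        then show ?thesis using that by (auto simp: pow_pmap_scale[symmetric] intro: span_scale)
      qed
    qed
    moreover have "(pmap ^^ k) ` Y \<subseteq> (pmap ^^ k) ` span Y" by (auto intro: span_base)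
    ultimately have "span ((pmap ^^ k) ` Y) \<subseteq> (pmap ^^ k) ` span Y" by (intro span_minimal)
    then show ?thesis using that by blast
  qed
  then show ?thesis unfolding relations_liftable_def by blast
qed

end

section \<open>Bases of Jordan chains\<close>

context abelian_restricted_lie_algebra
begin

definition chain_comb :: "'i set \<Rightarrow> ('i \<Rightarrow> 'l) \<Rightarrow> ('i \<Rightarrow> nat) \<Rightarrow> ('i \<Rightarrow> nat \<Rightarrow> 'f) \<Rightarrow> 'l" where
  "chain_comb I h e c = (\<Sum>i\<in>I. \<Sum>k<e i. scale (c i k) ((pmap ^^ k) (h i)))"

text \<open>Stating independence for the coefficients of an indexed family also makes the chain
  elements distinct. Chains of length 0 are allowed; their head is \<open>0\<close>.\<close>

definition chain_basis :: "'i set \<Rightarrow> ('i \<Rightarrow> 'l) \<Rightarrow> ('i \<Rightarrow> nat) \<Rightarrow> bool" where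
  "chain_basis I h e \<longleftrightarrow> finite I \<and> (\<forall>i\<in>I. (pmap ^^ e i) (h i) = 0) \<and>
    (\<forall>x. \<exists>c. x = chain_comb I h e c) \<and>
    (\<forall>c. chain_comb I h e c = 0 \<longrightarrow> (\<forall>i\<in>I. \<forall>k<e i. c i k = 0))"

lemma chain_comb_add:
  "chain_comb I h e c + chain_comb I h e d = chain_comb I h e (\<lambda>i k. c i k + d i k)"
  by (simp add: chain_comb_def scale_left_distrib sum.distrib)

lemma chain_comb_scale: "scale a (chain_comb I h e c) = chain_comb I h e (\<lambda>i k. a * c i k)"
  by (simp add: chain_comb_def scale_sum_right)

lemma chain_comb_diff:
  "chain_comb I h e c - chain_comb I h e d = chain_comb I h e (\<lambda>i k. c i k - d i k)"
  by (simp add: chain_comb_def scale_left_diff_distrib sum_subtractf)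

lemma subspace_range_chain_comb: "subspace (range (chain_comb I h e))"
proof (rule subspaceI)
  have "chain_comb I h e (\<lambda>_ _. 0) = 0" by (simp add: chain_comb_def)
  then show "0 \<in> range (chain_comb I h e)" by (metis rangeI)
qed (auto simp: chain_comb_add chain_comb_scale)

lemma chain_comb_delta:
  assumes "finite I" "i \<in> I" "k < e i"
  shows "chain_comb I h e (\<lambda>j l. if j = i \<and> l = k then 1 else 0) = (pmap ^^ k) (h i)"
proof -
  let ?c = "\<lambda>j l. if j = i \<and> l = k then 1 else (0::'f)"
  have "chain_comb I h e ?c = (\<Sum>j\<in>I. if j = i then (pmap ^^ k) (h i) else 0)"
    unfolding chain_comb_def
  proof (rule sum.cong[OF refl])
    fix j assume "j \<in> I"
    show "(\<Sum>l<e j. scale (?c j l) ((pmap ^^ l) (h j))) = (if j = i then (pmap ^^ k) (h i) else 0)"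
    proof (cases "j = i")
      case j: True
      have "(\<Sum>l<e j. scale (?c j l) ((pmap ^^ l) (h j))) =
          (\<Sum>l<e j. if l = k then (pmap ^^ k) (h i) else 0)"
        by (rule sum.cong) (simp_all add: j)
      also have "\<dots> = (pmap ^^ k) (h i)" using assms(3) by (subst sum.delta) (simp_all add: j)
      finally show ?thesis by (simp only: j simp_thms if_True)
    qed simp
  qed
  also have "\<dots> = (pmap ^^ k) (h i)" using assms(1,2) by (subst sum.delta) simp_all
  finally show ?thesis .
qed

lemma pow_pmap_in_range_chain_comb:
  assumes "finite I" "i \<in> I" "(pmap ^^ e i) (h i) = 0"
  shows "(pmap ^^ k) (h i) \<in> range (chain_comb I h e)"
proof (cases "k < e i")
  case True
  from range_eqI[where f = "chain_comb I h e", OF chain_comb_delta[OF assms(1,2), of k e h, OF True, symmetric]]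
  show ?thesis .
next
  case False
  then have "(pmap ^^ k) (h i) = 0"
    using pow_pmap_eq_zero_mono[OF assms(3)] by simp
  then show ?thesis using subspace_0[OF subspace_range_chain_comb] by simp
qed

text \<open>The members of the flag are mere sets: those used later are images under powers of a
  semilinear map and need not be subspaces. Starting from the trivial end, an independent set for
  one level is extended inside the next larger level.\<close>

lemma adapted_bases:
  fixes S :: "nat \<Rightarrow> 'l set"
  assumes "decseq S" "S n = {0}"
  obtains U where "decseq U" "U n = {}" "\<And>j. j < n \<Longrightarrow> U j \<subseteq> S j" "\<And>j. independent (U j)"
    "\<And>j. j < n \<Longrightarrow> S j \<subseteq> span (U j)"
proof -
  have "m \<le> n \<Longrightarrow> \<exists>U. decseq U \<and> (\<forall>j\<ge>n. U j = {}) \<and> (\<forall>j\<in>{n - m..<n}. U j \<subseteq> S j) \<and>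
      (\<forall>j. independent (U j)) \<and> (\<forall>j\<in>{n - m..<n}. S j \<subseteq> span (U j))" for m
  proof (induction m)
    case 0
    then show ?case
      by (intro exI[of _ "\<lambda>_. {}"]) (simp add: independent_empty antimono_def)
  next
    case (Suc m)
    then obtain U where U: "decseq U" "\<forall>j\<ge>n. U j = {}" "\<forall>j\<in>{n - m..<n}. U j \<subseteq> S j"
      "\<forall>j. independent (U j)" "\<forall>j\<in>{n - m..<n}. S j \<subseteq> span (U j)" by auto
    define k where "k = n - Suc m"
    have k: "Suc k = n - m" "k < n" using Suc.prems by (simp_all add: k_def)
    have "U (Suc k) \<subseteq> S k"
    proof (cases "Suc k < n")
      case True
      then have "U (Suc k) \<subseteq> S (Suc k)" using U(3) k by auto
      also have "S (Suc k) \<subseteq> S k" using assms(1) by (simp add: decseq_SucD)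
      finally show ?thesis .
    next
      case False
      then show ?thesis using U(2) by auto
    qed
    then obtain V where V: "U (Suc k) \<subseteq> V" "V \<subseteq> S k" "independent V" "S k \<subseteq> span V"
      using maximal_independent_subset_extend U(4) by metis
    \<comment> \<open>Levels below \<open>k\<close> get \<open>V\<close> only provisionally, so that
      the family stays decreasing; later steps replace them.\<close>
    let ?U = "\<lambda>j. if j \<le> k then V else U j"
    have "decseq ?U"
    proof (rule decseq_SucI)
      fix j
      consider "Suc j \<le> k" | "j = k" | "k < j" by linarith
      then show "?U (Suc j) \<subseteq> ?U j"
        using V(1) decseq_SucD[OF U(1), of j] by cases auto
    qed
    moreover have "{n - Suc m..<n} = insert k {n - m..<n}" using k by (auto simp: k_def)
    ultimately show ?case using U V k
      by (intro exI[of _ ?U]) auto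
  qed
  from this[of n] obtain U where U: "decseq U" "\<forall>j\<ge>n. U j = {}" "\<forall>j\<in>{0..<n}. U j \<subseteq> S j"
      "\<forall>j. independent (U j)" "\<forall>j\<in>{0..<n}. S j \<subseteq> span (U j)" by auto
  then show thesis by (intro that[of U]) auto
qed

lemma independent_sum_eq_zeroD:
  assumes "independent U" "finite U" "(\<Sum>u\<in>U. scale (c u) u) = 0" "u \<in> U"
  shows "c u = 0"
  using assms by (metis independentD subset_refl)

text \<open>Among the terms with nonzero coefficient, take those furthest from the end of their
  chain, at distance \<open>m\<close>. Applying the \<open>p\<close>-map \<open>m - 1\<close> times
  kills all other terms and moves these to the last chain elements, which are independent by
  \<open>indep\<close>.\<close>

lemma chain_independent:
  assumes "finite I" "\<And>i. i \<in> I \<Longrightarrow> (pmap ^^ e i) (h i) = 0"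
    and indep: "\<And>c. (\<Sum>i | i \<in> I \<and> e i > 0. scale (c i) ((pmap ^^ (e i - 1)) (h i))) = 0 \<Longrightarrow>
      \<forall>i\<in>I. e i > 0 \<longrightarrow> c i = 0"
    and zero: "chain_comb I h e c = 0" and "i \<in> I" "k < e i"
  shows "c i k = 0"
proof (rule ccontr)
  assume "c i k \<noteq> 0"
  define M where "M = {e i - k | i k. i \<in> I \<and> k < e i \<and> c i k \<noteq> 0}"
  have "M \<subseteq> (\<Union>i\<in>I. {..e i})" by (auto simp: M_def)
  then have M: "finite M" "e i - k \<in> M"
    using assms(1,5,6) \<open>c i k \<noteq> 0\<close> by (auto simp: M_def intro: finite_subset)
  define m where "m = Max M"
  have max: "c i k = 0" if "i \<in> I" "k < e i" "e i - k > m" for i k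
  proof (rule ccontr)
    assume "c i k \<noteq> 0"
    then have "e i - k \<le> m" unfolding m_def using that M(1) by (intro Max_ge) (auto simp: M_def)
    then show False using that by simp
  qed
  have "m \<in> M" unfolding m_def using M by (intro Max_in) auto
  then obtain i' k' where ik: "i' \<in> I" "k' < e i'" "c i' k' \<noteq> 0" "m = e i' - k'"
    by (auto simp: M_def)
  then obtain r where m: "m = Suc r" by (metis Suc_diff_Suc)
  define q where "q = p ^ r"
  have q: "q > 0" using p_pos by (simp add: q_def)
  \<comment> \<open>The coefficient that lands on the last element of chain \<open>i\<close>. The
    case distinction guards against chains shorter than \<open>m\<close>, where
    \<open>e i - m\<close> truncates to 0.\<close>
  let ?d = "\<lambda>i. if m \<le> e i then c i (e i - m) ^ q else 0"
  have "0 = (pmap ^^ r) (chain_comb I h e c)"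
    by (simp add: zero pow_pmap_zero)
  also have "\<dots> = (\<Sum>i\<in>I. \<Sum>k<e i. scale (c i k ^ q) ((pmap ^^ (r + k)) (h i)))"
    by (simp add: chain_comb_def pow_pmap_sum pow_pmap_scale pow_pmap_pow_pmap q_def)
  also have "\<dots> = (\<Sum>i\<in>I. if e i > 0 then scale (?d i) ((pmap ^^ (e i - 1)) (h i)) else 0)"
  proof (rule sum.cong[OF refl])
    fix i assume i: "i \<in> I"
    have "scale (c i k ^ q) ((pmap ^^ (r + k)) (h i)) =
        (if k = e i - m then scale (?d i) ((pmap ^^ (e i - 1)) (h i)) else 0)" if k: "k < e i" for k
    proof -
      consider "e i - k > m" | "e i - k < m" | "e i - k = m" by linarith
      then show ?thesis
      proof cases
        case 1
        then have "k \<noteq> e i - m" using k by auto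
        then show ?thesis using max[OF i k 1] q by (simp add: zero_power)
      next
        case 2
        then have "e i \<le> r + k" using m k by linarith
        then have "(pmap ^^ (r + k)) (h i) = 0"
          by (rule pow_pmap_eq_zero_mono[OF assms(2)[OF i]])
        moreover have "k = e i - m \<Longrightarrow> \<not> m \<le> e i" using 2 k by auto
        ultimately show ?thesis using q by (auto simp: zero_power)
      next
        case 3
        then have "k = e i - m" "m \<le> e i" "r + k = e i - 1" using k m by auto
        then show ?thesis by simp
      qed
    qed
    then have "(\<Sum>k<e i. scale (c i k ^ q) ((pmap ^^ (r + k)) (h i))) =
        (\<Sum>k<e i. if k = e i - m then scale (?d i) ((pmap ^^ (e i - 1)) (h i)) else 0)"
      by (intro sum.cong) auto
    also have "\<dots> = (if e i > 0 then scale (?d i) ((pmap ^^ (e i - 1)) (h i)) else 0)"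
      using m by (subst sum.delta) auto
    finally show "(\<Sum>k<e i. scale (c i k ^ q) ((pmap ^^ (r + k)) (h i))) = \<dots>" .
  qed
  also have "\<dots> = (\<Sum>i | i \<in> I \<and> e i > 0. scale (?d i) ((pmap ^^ (e i - 1)) (h i)))"
    by (rule sum.inter_filter[symmetric]) (rule assms(1))
  finally have "\<forall>i\<in>I. e i > 0 \<longrightarrow> ?d i = 0"
    by (intro indep) simp
  then have "?d i' = 0" using ik by auto
  moreover have "e i' - m = k'" "m \<le> e i'" using ik by auto
  ultimately show False using ik(3) by simp
qed

lemma relations_liftableD:
  assumes "relations_liftable" "(pmap ^^ k) x \<in> span ((pmap ^^ k) ` Y)" "finite Y"
  shows "\<exists>y\<in>span Y. (pmap ^^ k) x = (pmap ^^ k) y"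
  using assms unfolding relations_liftable_def by blast

text \<open>The vectors of the adapted basis become the ends of the chains: a vector in exactly
  \<open>e\<close> levels is the end of a chain of length \<open>e\<close>. Independence of the
  chains follows from that of their ends; liftability serves to prove spanning.\<close>

lemma relations_liftable_imp_chain_basis:
  assumes "relations_liftable" "finite_dimensional" "p_nilpotent"
  obtains I :: "'l set" and h e where "chain_basis I h e"
proof -
  obtain n where n: "n \<ge> 1" "\<And>x. (pmap ^^ n) x = 0"
    using uniform_nilpotency assms by blast
  \<comment> \<open>The image of the \<open>j\<close>-th power intersected with the kernel of the
    \<open>p\<close>-map, that is, the possible ends of chains of length at least
    \<open>j + 1\<close>.\<close>
  define S where "S j = (pmap ^^ j) ` {x. (pmap ^^ Suc j) x = 0}" for j
  have "decseq S"
  proof (rule decseq_SucI, rule subsetI)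
    fix j y assume "y \<in> S (Suc j)"
    then obtain x where x: "y = (pmap ^^ Suc j) x" "(pmap ^^ Suc (Suc j)) x = 0"
      by (auto simp: S_def)
    have "y = (pmap ^^ j) (pmap x)" by (simp add: x(1) funpow_swap1)
    moreover have "(pmap ^^ Suc j) (pmap x) = 0" using x(2) by (simp add: funpow_swap1)
    ultimately show "y \<in> S j" by (auto simp: S_def)
  qed
  moreover have "S n = {0}"
    using n(2) pow_pmap_zero[of "Suc n"] by (auto simp: S_def)
  ultimately obtain U where U: "decseq U" "U n = {}" "\<And>j. j < n \<Longrightarrow> U j \<subseteq> S j"
      "\<And>j. independent (U j)" "\<And>j. j < n \<Longrightarrow> S j \<subseteq> span (U j)"
    using adapted_bases by metis
  define I where "I = U 0"
  from assms(2) obtain B where "finite B" "span B = UNIV" by (auto simp: finite_dimensional_def)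
  then have fin: "finite I"
    using independent_span_bound[of B I] U(4) by (auto simp: I_def)
  define e where "e u = (LEAST j. u \<notin> U j)" for u
  have e_le: "e u \<le> n" for u
    unfolding e_def using U(2) by (intro Least_le) simp
  have mem_U: "u \<in> U j \<longleftrightarrow> j < e u" for u j
  proof
    have ne: "u \<notin> U (e u)" unfolding e_def by (rule LeastI[of _ n]) (simp add: U(2))
    show "j < e u" if "u \<in> U j"
    proof (rule ccontr)
      assume "\<not> j < e u"
      then have "U j \<subseteq> U (e u)" using U(1) by (simp add: decseq_def)
      then show False using that ne by blast
    qed
    show "u \<in> U j" if "j < e u"
      using not_less_Least[of j "\<lambda>j. u \<notin> U j"] that by (simp add: e_def)
  qed
  have "\<exists>x. (pmap ^^ (e u - 1)) x = u \<and> (pmap ^^ e u) x = 0" if "u \<in> I" for u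
  proof -
    have pos: "0 < e u" using that mem_U[of u 0] by (simp add: I_def)
    then have "u \<in> U (e u - 1)" "e u - 1 < n" using mem_U e_le[of u] by auto
    then have "u \<in> S (e u - 1)" using U(3) by blast
    then obtain x where "u = (pmap ^^ (e u - 1)) x" "(pmap ^^ Suc (e u - 1)) x = 0"
      unfolding S_def by blast
    moreover have "Suc (e u - 1) = e u" using pos by simp
    ultimately show ?thesis by (intro exI[of _ x]) simp
  qed
  then obtain h where h: "\<And>u. u \<in> I \<Longrightarrow> (pmap ^^ (e u - 1)) (h u) = u"
    "\<And>u. u \<in> I \<Longrightarrow> (pmap ^^ e u) (h u) = 0" by metis
  let ?W = "range (chain_comb I h e)"
  \<comment> \<open>For \<open>j = n\<close> the kernel is all of L, so this induction yields the
    spanning property.\<close>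
  have ker_sub: "j \<le> n \<Longrightarrow> {x. (pmap ^^ j) x = 0} \<subseteq> ?W" for j
  proof (induction j)
    case 0
    show ?case using subspace_0[OF subspace_range_chain_comb, of I h e] by auto
  next
    case (Suc j)
    show ?case
    proof
      fix x assume "x \<in> {x. (pmap ^^ Suc j) x = 0}"
      then have "(pmap ^^ j) x \<in> S j" by (auto simp: S_def)
      then have x: "(pmap ^^ j) x \<in> span (U j)" using subsetD[OF U(5)[of j]] Suc.prems by simp
      \<comment> \<open>The chain elements that the \<open>j\<close>-th power maps onto
        \<open>U j\<close>; the subtraction is exact because \<open>u \<in> U j\<close> means
        \<open>j < e u\<close>.\<close>
      let ?Y = "(\<lambda>u. (pmap ^^ (e u - 1 - j)) (h u)) ` U j"
      have UI: "U j \<subseteq> I" using U(1) by (simp add: I_def decseq_def)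
      have "(pmap ^^ j) ` ?Y = (\<lambda>u. u) ` U j"
        unfolding image_image
      proof (rule image_cong[OF refl])
        fix u assume u: "u \<in> U j"
        then have "j + (e u - 1 - j) = e u - 1" using mem_U by auto
        then show "(pmap ^^ j) ((pmap ^^ (e u - 1 - j)) (h u)) = u"
          using h(1) u UI by (auto simp: pow_pmap_pow_pmap)
      qed
      with x have "(pmap ^^ j) x \<in> span ((pmap ^^ j) ` ?Y)" by simp
      moreover have "finite ?Y" using fin UI by (auto intro: finite_subset)
      \<comment> \<open>Liftability supplies a combination \<open>y\<close> of chain elements with
        the same \<open>j\<close>-th power as \<open>x\<close>; the difference falls into the
        smaller kernel.\<close>
      ultimately have "\<exists>y\<in>span ?Y. (pmap ^^ j) x = (pmap ^^ j) y"
        by (rule relations_liftableD[OF assms(1)])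
      then obtain y where y: "y \<in> span ?Y" "(pmap ^^ j) x = (pmap ^^ j) y"
        by (elim bexE)
      have "?Y \<subseteq> ?W"
      proof (rule image_subsetI)
        fix u assume "u \<in> U j"
        then show "(pmap ^^ (e u - 1 - j)) (h u) \<in> ?W"
          using UI fin h(2) by (intro pow_pmap_in_range_chain_comb) blast+
      qed
      from subsetD[OF span_minimal[OF this subspace_range_chain_comb] y(1)] have "y \<in> ?W" .
      moreover have "x - y \<in> {x. (pmap ^^ j) x = 0}"
        by (simp add: pow_pmap_diff y(2))
      then have "x - y \<in> ?W" using Suc by (meson Suc_leD subsetD)
      ultimately have "(x - y) + y \<in> ?W" by (intro subspace_add[OF subspace_range_chain_comb])
      then show "x \<in> ?W" by simp
    qed
  qed
  have "chain_basis I h e"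
    unfolding chain_basis_def
  proof (intro conjI allI impI ballI)
    show "finite I" by (rule fin)
    show "(pmap ^^ e i) (h i) = 0" if "i \<in> I" for i using that by (rule h(2))
    show "\<exists>c. x = chain_comb I h e c" for x
      using subsetD[OF ker_sub[of n], of x] n(2) by auto
    fix c i k assume c: "chain_comb I h e c = 0" and ik: "i \<in> I" "k < e i"
    have "{i \<in> I. 0 < e i} = I" using mem_U[of _ 0] by (auto simp: I_def)
    then have "\<forall>i\<in>I. 0 < e i \<longrightarrow> c i = 0"
      if "(\<Sum>i | i \<in> I \<and> 0 < e i. scale (c i) ((pmap ^^ (e i - 1)) (h i))) = 0" for c :: "'l \<Rightarrow> 'f"
      using that independent_sum_eq_zeroD[of I c] U(4)[of 0] fin h(1) by (simp add: I_def)
    note indep = this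
    show "c i k = 0"
      by (rule chain_independent[of I e h c i k]) (fact fin h(2) indep c ik)+
  qed
  then show thesis by (rule that)
qed

end

section \<open>Direct sums of cyclic restricted subalgebras\<close>

context abelian_restricted_lie_algebra
begin

lemma restricted_subalgebra_iff:
  "restricted_subalgebra S \<longleftrightarrow> subspace S \<and> (\<forall>x\<in>S. pmap x \<in> S)"
  by (auto simp: restricted_subalgebra_def bracket_eq_zero subspace_0)

lemma chain_comb_eq_sum: "chain_comb I h e c = (\<Sum>i\<in>I. chain_comb {i} h e c)"
  by (simp add: chain_comb_def)

lemma restricted_subalgebra_range_chain_comb:
  assumes "finite I" "\<And>i. i \<in> I \<Longrightarrow> (pmap ^^ e i) (h i) = 0"
  shows "restricted_subalgebra (range (chain_comb I h e))"
  unfolding restricted_subalgebra_iff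
proof (intro conjI ballI)
  show "subspace (range (chain_comb I h e))" by (rule subspace_range_chain_comb)
  fix x assume "x \<in> range (chain_comb I h e)"
  then obtain c where c: "x = chain_comb I h e c" by blast
  have "(pmap ^^ 1) x = (\<Sum>i\<in>I. \<Sum>k<e i. scale (c i k ^ (p ^ 1)) ((pmap ^^ (1 + k)) (h i)))"
    unfolding c chain_comb_def pow_pmap_sum pow_pmap_scale pow_pmap_pow_pmap ..
  moreover have "(pmap ^^ (1 + k)) (h i) \<in> range (chain_comb I h e)" if "i \<in> I" for i k
    using assms that by (intro pow_pmap_in_range_chain_comb)
  ultimately have "(pmap ^^ 1) x \<in> range (chain_comb I h e)"
    by (simp only:) (intro subspace_sum subspace_scale subspace_range_chain_comb)
  then show "pmap x \<in> range (chain_comb I h e)" by simp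
qed

lemma hull_eq_range_chain_comb:
  assumes "(pmap ^^ e i) (h i) = 0"
  shows "restricted_subalgebra hull {h i} = range (chain_comb {i} h e)"
proof (rule hull_unique)
  show "{h i} \<subseteq> range (chain_comb {i} h e)"
    using pow_pmap_in_range_chain_comb[of "{i}" i e h 0] assms by simp
  show "restricted_subalgebra (range (chain_comb {i} h e))"
    using assms by (intro restricted_subalgebra_range_chain_comb) auto
  fix S assume S: "{h i} \<subseteq> S" "restricted_subalgebra S"
  have "(pmap ^^ k) (h i) \<in> S" for k
    using S by (induction k) (auto simp: restricted_subalgebra_iff)
  then show "range (chain_comb {i} h e) \<subseteq> S"
    using S(2) by (auto simp: chain_comb_def restricted_subalgebra_iff
        intro!: subspace_sum subspace_scale)
qed

lemma chain_comb_cong: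
  "(\<And>i k. i \<in> I \<Longrightarrow> k < e i \<Longrightarrow> c i k = d i k) \<Longrightarrow> chain_comb I h e c = chain_comb I h e d"
  by (simp add: chain_comb_def)

lemma chain_basis_finite: "chain_basis I h e \<Longrightarrow> finite I"
  and chain_basis_zero: "chain_basis I h e \<Longrightarrow> i \<in> I \<Longrightarrow> (pmap ^^ e i) (h i) = 0"
  and chain_basis_span: "chain_basis I h e \<Longrightarrow> \<exists>c. x = chain_comb I h e c"
  by (simp_all add: chain_basis_def)

lemma chain_basis_indep:
  "chain_basis I h e \<Longrightarrow> chain_comb I h e c = 0 \<Longrightarrow> i \<in> I \<Longrightarrow> k < e i \<Longrightarrow> c i k = 0"
  by (simp add: chain_basis_def)

text \<open>The chains just constructed are indexed by vectors of L, whereas the summands of a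
  decomposition are indexed by natural numbers.\<close>

lemma chain_basis_reindex:
  assumes g: "bij_betw g J I" and basis: "chain_basis I h e"
  shows "chain_basis J (h \<circ> g) (e \<circ> g)"
proof -
  have comb: "chain_comb I h e c = chain_comb J (h \<circ> g) (e \<circ> g) (\<lambda>j. c (g j))" for c
    unfolding chain_comb_def
    by (subst sum.reindex_bij_betw[OF g, symmetric]) simp
  show ?thesis
    unfolding chain_basis_def
  proof (intro conjI allI impI ballI)
    show "finite J" using bij_betw_finite[OF g] chain_basis_finite[OF basis] by simp
    show "(pmap ^^ (e \<circ> g) j) ((h \<circ> g) j) = 0" if "j \<in> J" for j
      using bij_betwE[OF g] that chain_basis_zero[OF basis] by simp
    show "\<exists>c. x = chain_comb J (h \<circ> g) (e \<circ> g) c" for x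
    proof -
      obtain c where "x = chain_comb I h e c" using chain_basis_span[OF basis] by blast
      then show ?thesis unfolding comb by (intro exI[of _ "\<lambda>j. c (g j)"])
    qed
    fix c j k assume c: "chain_comb J (h \<circ> g) (e \<circ> g) c = 0" and j: "j \<in> J" "k < (e \<circ> g) j"
    let ?d = "\<lambda>i. c (inv_into J g i)"
    have inv: "inv_into J g (g j) = j" if "j \<in> J" for j
      using that g by (simp add: bij_betw_inv_into_left)
    have "chain_comb I h e ?d = 0"
      unfolding comb c[symmetric] by (rule chain_comb_cong) (simp add: inv)
    then have "?d (g j) k = 0"
      using chain_basis_indep[OF basis, of ?d "g j" k] j bij_betwE[OF g] by simp
    then show "c j k = 0" using inv[OF j(1)] by simp
  qed
qed

lemma chain_basis_imp_decomposes:
  assumes "chain_basis I h e"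
  shows "decomposes_into_cyclics"
proof -
  obtain g :: "nat \<Rightarrow> _" where "bij_betw g {0..<card I} I"
    using ex_bij_betw_nat_finite[OF chain_basis_finite[OF assms]] by blast
  from chain_basis_reindex[OF this assms]
  obtain J :: "nat set" and h e where basis: "chain_basis J h e" by (rule that)
  note J = chain_basis_finite[OF basis] chain_basis_zero[OF basis]
  define S where "S i = range (chain_comb {i} h e)" for i
  have "direct_sum_of J S"
    unfolding direct_sum_of_def
  proof (intro conjI ballI impI allI)
    show "finite J" by (rule J)
    show "restricted_subalgebra (S i)" if "i \<in> J" for i
      unfolding S_def using that J(2) by (intro restricted_subalgebra_range_chain_comb) auto
    fix x
    show "\<exists>!f. f \<in> Pi\<^sub>E J S \<and> x = sum f J"
    proof (rule ex_ex1I)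
      obtain c where "x = chain_comb J h e c" using chain_basis_span[OF basis] by blast
      then have "x = sum (\<lambda>i\<in>J. chain_comb {i} h e c) J"
        by (simp add: chain_comb_eq_sum[of J])
      moreover have "(\<lambda>i\<in>J. chain_comb {i} h e c) \<in> Pi\<^sub>E J S" by (auto simp: S_def)
      ultimately show "\<exists>f. f \<in> Pi\<^sub>E J S \<and> x = sum f J" by blast
      have ex: "\<exists>c. \<forall>i\<in>J. f i = chain_comb {i} h e c" if "f \<in> Pi\<^sub>E J S" for f
      proof -
        have "\<forall>i\<in>J. \<exists>c. f i = chain_comb {i} h e c" using PiE_mem[OF that] by (auto simp: S_def)
        then obtain c where c: "\<And>i. i \<in> J \<Longrightarrow> f i = chain_comb {i} h e (c i)" by metis
        \<comment> \<open>Only row \<open>i\<close> of the coefficients matters for chain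
          \<open>i\<close>, so the separate choices merge along the diagonal.\<close>
        have "f i = chain_comb {i} h e (\<lambda>i. c i i)" if "i \<in> J" for i
          unfolding c[OF that] by (rule chain_comb_cong) simp
        then show ?thesis by (intro exI[of _ "\<lambda>i. c i i"]) blast
      qed
      fix f f' assume f: "f \<in> Pi\<^sub>E J S \<and> x = sum f J" "f' \<in> Pi\<^sub>E J S \<and> x = sum f' J"
      obtain c where c: "\<And>i. i \<in> J \<Longrightarrow> f i = chain_comb {i} h e c" using ex f(1) by blast
      obtain c' where c': "\<And>i. i \<in> J \<Longrightarrow> f' i = chain_comb {i} h e c'" using ex f(2) by blast
      have "chain_comb J h e c = sum f J" "chain_comb J h e c' = sum f' J"
        by (simp_all add: chain_comb_eq_sum[of J] c c')
      then have "chain_comb J h e (\<lambda>i k. c i k - c' i k) = 0"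
        using f by (simp add: chain_comb_diff[symmetric])
      then have eq: "c i k = c' i k" if "i \<in> J" "k < e i" for i k
        using chain_basis_indep[OF basis _ that] by fastforce
      show "f = f'"
      proof (rule PiE_ext)
        show "f \<in> Pi\<^sub>E J S" "f' \<in> Pi\<^sub>E J S" using f by auto
        show "f i = f' i" if "i \<in> J" for i
          unfolding c[OF that] c'[OF that] using eq that by (intro chain_comb_cong) auto
      qed
    qed
  qed (auto simp: bracket_eq_zero)
  moreover have "cyclic_restricted_subalgebra (S i)" if "i \<in> J" for i
    unfolding cyclic_restricted_subalgebra_def S_def
    using hull_eq_range_chain_comb[of e i h] J(2)[OF that] by (intro exI[of _ "h i"]) simp
  ultimately show ?thesis unfolding decomposes_into_cyclics_def by blast
qed

text \<open>Minimality of the length makes the last chain element nonzero, which gives independence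
  inside each summand; uniqueness of the decomposition of \<open>0\<close> separates the
  summands.\<close>

lemma decomposes_imp_chain_basis:
  assumes "decomposes_into_cyclics" "p_nilpotent"
  obtains I :: "nat set" and h e where "chain_basis I h e"
proof -
  obtain I :: "nat set" and S where S: "direct_sum_of I S"
    "\<And>i. i \<in> I \<Longrightarrow> cyclic_restricted_subalgebra (S i)"
    using assms(1) unfolding decomposes_into_cyclics_def by blast
  then have "\<forall>i\<in>I. \<exists>x. S i = restricted_subalgebra hull {x}"
    by (simp add: cyclic_restricted_subalgebra_def)
  then obtain h where h: "\<And>i. i \<in> I \<Longrightarrow> S i = restricted_subalgebra hull {h i}" by metis
  define e where "e i = (LEAST n. (pmap ^^ n) (h i) = 0)" for i
  have e: "(pmap ^^ e i) (h i) = 0" for i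
  proof -
    obtain n where "(pmap ^^ n) (h i) = 0" using assms(2) unfolding p_nilpotent_def by blast
    then show ?thesis unfolding e_def by (rule LeastI)
  qed
  have nz: "(pmap ^^ (e i - 1)) (h i) \<noteq> 0" if "e i > 0" for i
    using not_less_Least[of "e i - 1" "\<lambda>n. (pmap ^^ n) (h i) = 0"] that by (simp add: e_def)
  have range: "S i = range (chain_comb {i} h e)" if "i \<in> I" for i
    using h[OF that] hull_eq_range_chain_comb[of e i h] e by simp
  have fin: "finite I" and uniq: "\<exists>!f. f \<in> Pi\<^sub>E I S \<and> x = sum f I" for x
    using S(1) by (auto simp: direct_sum_of_def)
  have "chain_basis I h e"
    unfolding chain_basis_def
  proof (intro conjI allI impI ballI)
    show "finite I" by (rule fin)
    show "(pmap ^^ e i) (h i) = 0" for i by (rule e)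
    show "\<exists>c. x = chain_comb I h e c" for x
    proof -
      obtain f where f: "f \<in> Pi\<^sub>E I S" "x = sum f I" using uniq[of x] by blast
      have "\<exists>c. f i = chain_comb {i} h e c" if "i \<in> I" for i
        using PiE_mem[OF f(1) that] unfolding range[OF that] by (elim rangeE) (rule exI)
      then obtain c where c: "\<And>i. i \<in> I \<Longrightarrow> f i = chain_comb {i} h e (c i)" by metis
      have "f i = chain_comb {i} h e (\<lambda>i. c i i)" if "i \<in> I" for i
        unfolding c[OF that] by (rule chain_comb_cong) simp
      then have "x = chain_comb I h e (\<lambda>i. c i i)" by (simp add: f(2) chain_comb_eq_sum[of I])
      then show ?thesis by blast
    qed
    fix c i k assume c: "chain_comb I h e c = 0" and ik: "i \<in> I" "k < e i"
    let ?f = "\<lambda>i\<in>I. chain_comb {i} h e c" and ?g = "\<lambda>i\<in>I. 0 :: 'l"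
    have "?f \<in> Pi\<^sub>E I S \<and> 0 = sum ?f I"
      using c range by (auto simp: chain_comb_eq_sum[of I])
    moreover have "?g \<in> Pi\<^sub>E I S \<and> 0 = sum ?g I"
      using subspace_0[OF subspace_range_chain_comb] range by auto
    ultimately have "?f = ?g" using uniq[of 0] by (elim ex1E) metis
    then have "?f i = ?g i" by (rule fun_cong)
    then have zero: "chain_comb {i} h e c = 0" using ik by simp
    have "\<forall>j\<in>{i}. 0 < e j \<longrightarrow> d j = 0"
      if "(\<Sum>j | j \<in> {i} \<and> 0 < e j. scale (d j) ((pmap ^^ (e j - 1)) (h j))) = 0" for d :: "nat \<Rightarrow> 'f"
    proof -
      have "{j. j \<in> {i} \<and> 0 < e j} = {i}" using ik by auto
      then show ?thesis using that nz[of i] ik by simp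
    qed
    then show "c i k = 0"
      using zero ik(2) e by (intro chain_independent[of "{i}" e h c i k]) auto
  qed
  then show thesis by (rule that)
qed

end

section \<open>Multiplicative bases lift relations\<close>

lemma single_sum:
  "Poly_Mapping.single m (sum f S) = (\<Sum>i\<in>S. Poly_Mapping.single m (f i))"
  by (induction S rule: infinite_finite_induct) (simp_all add: single_add)

context abelian_restricted_lie_algebra
begin

interpretation A: assoc_algebra class_ring restricted_enveloping_algebra
  by (rule assoc_algebra_restricted_enveloping_algebra)

lemma exists_linear_functional:
  assumes "x \<noteq> 0"
  obtains f :: "'l \<Rightarrow> 'f" where "\<And>u v. f (u + v) = f u + f v" "\<And>c u. f (scale c u) = c * f u" "f x = 1"
proof -
  interpret F: vector_space "(*) :: 'f \<Rightarrow> 'f \<Rightarrow> 'f"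
    by unfold_locales (simp_all add: algebra_simps)
  interpret vp: vector_space_pair scale "(*) :: 'f \<Rightarrow> 'f \<Rightarrow> 'f" ..
  have "independent {x}" using assms by simp
  then obtain f where f: "Vector_Spaces.linear scale (*) f" "\<forall>u\<in>{x}. f u = (1::'f)"
    using vp.linear_independent_extend[of "{x}" "\<lambda>_. 1"] by blast
  interpret f: Vector_Spaces.linear scale "(*)" f by (rule f(1))
  show thesis using that[of f] f(2) by (simp add: f.add f.scale)
qed

text \<open>Injectivity of L into u(L). No basis adapted to the \<open>p\<close>-map is available
  yet, so the test map is built from one linear functional with \<open>f x = 1\<close>, evaluated
  along orbits of the \<open>p\<close>-map.\<close>

lemma comm_proj_gen_eq_zeroD:
  assumes n: "n \<ge> 1" "\<And>x. (pmap ^^ n) x = 0"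
    and x: "comm_proj (gen x) = \<zero>\<^bsub>restricted_enveloping_algebra\<^esub>"
  shows "x = 0"
proof (rule ccontr)
  assume "x \<noteq> 0"
  then obtain f :: "'l \<Rightarrow> 'f" where f: "\<And>u v. f (u + v) = f u + f v"
    "\<And>c u. f (scale c u) = c * f u" "f x = 1"
    using exists_linear_functional by blast
  have prime: "prime CHAR('f)" "prime CHAR('f poly)" using prime_p by (simp_all add: char_p)
  obtain r where r: "n = Suc r" using n(1) by (metis Suc_diff_1 less_eq_Suc_le One_nat_def)
  \<comment> \<open>The \<open>i\<close>-th term of \<open>\<theta> (pmap x)\<close> is
    \<open>a x i\<close>, and the \<open>p\<close>-th power of the \<open>i\<close>-th term of
    \<open>\<theta> x\<close> is \<open>a x (Suc i)\<close>. The difference telescopes to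
    \<open>a x n - a x 0\<close>, where \<open>a x 0\<close> vanishes by nilpotency and
    \<open>a x n\<close> is a multiple of Y to the power \<open>p ^ n\<close>.\<close>
  define a where "a x i = monom (f ((pmap ^^ (n - i)) x) ^ (p ^ i)) (p ^ i)" for x i
  txt \<open>With \<open>F\<close> acting on \<open>F[Y]\<close> through \<open>c \<mapsto> c\<^bsup>q\<^esup>\<close>, \<open>q = p\<^bsup>n-1\<^esup>\<close>, the linear form
    \<open>f\<close> extends to a linear map from \<open>L\<close> to \<open>F[Y]/(Y\<^bsup>p^n\<^esup>)\<close> which turns the \<open>p\<close>-map into the
    \<open>p\<close>-th power.\<close>
  define \<theta> where "\<theta> x = (\<Sum>i<n. monom (f ((pmap ^^ (r - i)) x) ^ (p ^ i)) (p ^ i))" for x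
  let ?\<phi> = "\<lambda>c::'f. [:c ^ (p ^ r):]"
  let ?I = "{g. monom 1 (p ^ n) dvd g}"
  have "poly_mapping_eval ?\<phi> (\<lambda>M. \<Prod>x\<in>#M. \<theta> x) (gen x) \<in> ?I"
  proof (rule comm_proj_eq_zero_imp_mem)
    show "?\<phi> (a + b) = ?\<phi> a + ?\<phi> b" for a b
      using freshmans_dream'[OF prime(1), of "p ^ r" r a b] by (simp add: char_p)
    show "?\<phi> (a * b) = ?\<phi> a * ?\<phi> b" for a b by (simp add: power_mult_distrib)
    show "?\<phi> 1 = 1" by (simp add: one_pCons)
    show "g + h \<in> ?I" if "g \<in> ?I" "h \<in> ?I" for g h using that by simp
    show "h * g \<in> ?I" if "g \<in> ?I" for g h using that by simp
    have "(u + v) ^ (p ^ i) = u ^ (p ^ i) + v ^ (p ^ i)" for u v :: 'f and i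
      using freshmans_dream'[OF prime(1), of "p ^ i" i u v] by (simp add: char_p)
    then show "\<theta> (x + y) - (\<theta> x + \<theta> y) \<in> ?I" for x y
      by (simp add: \<theta>_def pow_pmap_add f add_monom[symmetric] sum.distrib)
    have "\<theta> (scale c x) = ?\<phi> c * \<theta> x" for c x
    proof -
      have "monom (f ((pmap ^^ (r - i)) (scale c x)) ^ (p ^ i)) (p ^ i) =
          ?\<phi> c * monom (f ((pmap ^^ (r - i)) x) ^ (p ^ i)) (p ^ i)" if "i < n" for i
      proof -
        \<comment> \<open>The exponent \<open>p ^ (r - i)\<close> from semilinearity and the outer
          exponent \<open>p ^ i\<close> multiply to \<open>p ^ r\<close> for every \<open>i\<close>;
          this is why scalars act through that power.\<close>
        have "(c ^ (p ^ (r - i))) ^ (p ^ i) = c ^ (p ^ r)"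
          using that r by (simp add: power_mult[symmetric] power_add[symmetric])
        then show ?thesis by (simp add: pow_pmap_scale f power_mult_distrib smult_monom)
      qed
      then show ?thesis by (simp add: \<theta>_def sum_distrib_left)
    qed
    then show "\<theta> (scale c x) - ?\<phi> c * \<theta> x \<in> ?I" for c x by simp
    show "\<theta> x ^ p - \<theta> (pmap x) \<in> ?I" for x
    proof -
      have "\<theta> x ^ p = (\<Sum>i<n. a x (Suc i))"
        unfolding \<theta>_def using prime(2)
        by (subst freshmans_dream_sum) (auto simp: char_p monom_power a_def r power_mult[symmetric] mult.commute)
      moreover have "\<theta> (pmap x) = (\<Sum>i<n. a x i)"
        unfolding \<theta>_def a_def
        by (rule sum.cong) (auto simp: r Suc_diff_le funpow_swap1)
      moreover have "(\<Sum>i<n. a x (Suc i)) + a x 0 = (\<Sum>i<n. a x i) + a x n"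
        using sum.lessThan_Suc_shift[of "a x" n] by (simp add: add.commute)
      moreover have "a x 0 = 0" using f(2)[of 0 0] by (simp add: a_def n(2))
      ultimately have "\<theta> x ^ p - \<theta> (pmap x) = a x n" by (simp add: algebra_simps)
      then show ?thesis by (simp add: a_def monom_1_dvd_iff')
    qed
    show "comm_proj (gen x) = \<zero>\<^bsub>restricted_enveloping_algebra\<^esub>" by (rule x)
  qed
  moreover have "poly_mapping_eval ?\<phi> (\<lambda>M. \<Prod>x\<in>#M. \<theta> x) (gen x) = \<theta> x"
    unfolding gen_def
    using freshmans_dream'[OF prime(1), of "p ^ r" r]
    by (subst poly_mapping_eval_single) (auto simp: char_p)
  ultimately have "monom 1 (p ^ n) dvd \<theta> x" by simp
  moreover have "p ^ r < p ^ n" using prime_gt_1_nat[OF prime_p] r by simp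
  ultimately have "coeff (\<theta> x) (p ^ r) = 0" by (simp add: monom_1_dvd_iff')
  \<comment> \<open>Only the top term \<open>i = r\<close> contributes, and its coefficient is
    \<open>f x ^ (p ^ r) = 1\<close>.\<close>
  moreover have "coeff (\<theta> x) (p ^ r) = (\<Sum>i<n. if i = r then f x ^ (p ^ r) else 0)"
    unfolding \<theta>_def coeff_sum using prime_gt_1_nat[OF prime_p]
    by (intro sum.cong) auto
  ultimately show False using r f(3) by simp
qed

section \<open>Calculations in u(L) with polynomial representatives\<close>

lemma comm_proj_sum_cong:
  "(\<And>i. i \<in> S \<Longrightarrow> comm_proj (f i) = comm_proj (g i)) \<Longrightarrow> comm_proj (sum f S) = comm_proj (sum g S)"
proof (induction S rule: infinite_finite_induct)
  case (insert i S)
  then have "comm_proj (f i) = comm_proj (g i)" "comm_proj (sum f S) = comm_proj (sum g S)" by simp_all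
  then show ?case using insert.hyps by (simp add: comm_proj_add)
qed simp_all

lemma comm_proj_mult_cong:
  "comm_proj f = comm_proj f' \<Longrightarrow> comm_proj g = comm_proj g' \<Longrightarrow> comm_proj (f * g) = comm_proj (f' * g')"
  by (simp add: comm_proj_mult)

lemma comm_proj_power_cong: "comm_proj f = comm_proj g \<Longrightarrow> comm_proj (f ^ n) = comm_proj (g ^ n)"
  by (induction n) (simp_all add: comm_proj_mult)

lemma comm_proj_eq_iff:
  "comm_proj f = comm_proj g \<longleftrightarrow> comm_proj (f - g) = \<zero>\<^bsub>restricted_enveloping_algebra\<^esub>"
proof -
  have "comm_proj f = comm_proj (f - g) \<oplus>\<^bsub>restricted_enveloping_algebra\<^esub> comm_proj g"
    by (simp add: comm_proj_add[symmetric])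
  then show ?thesis by (metis A.module.M.add.r_cancel_one' comm_proj_closed A.module.M.l_zero A.module.M.add.l_cancel_one)
qed

lemma comm_proj_gen_zero: "comm_proj (gen 0) = \<zero>\<^bsub>restricted_enveloping_algebra\<^esub>"
  using comm_proj_gen_scale[of 0 0] by (simp add: comm_proj_zero)

lemma comm_proj_gen_sum:
  "comm_proj (gen (\<Sum>y\<in>Y. scale (d y) (f y))) =
    comm_proj (\<Sum>y\<in>Y. Poly_Mapping.single 0 (d y) * gen (f y))"
  by (induction Y rule: infinite_finite_induct)
    (simp_all add: comm_proj_gen_zero comm_proj_zero comm_proj_gen_add comm_proj_gen_scale comm_proj_add)

text \<open>A two-term linear combination, indexed by the booleans.\<close>

lemma comm_proj_gen_diff: "comm_proj (gen (x - y)) = comm_proj (gen x - gen y)"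
  using comm_proj_gen_sum[of "\<lambda>i. if i then 1 else - 1" "\<lambda>i. if i then x else y" UNIV]
  by (simp add: UNIV_bool single_uminus)

lemma comm_proj_gen_pow_pmap: "comm_proj (gen ((pmap ^^ k) x)) = comm_proj (gen x ^ (p ^ k))"
proof (induction k)
  case (Suc k)
  have "comm_proj (gen ((pmap ^^ Suc k) x)) = comm_proj (gen ((pmap ^^ k) x) ^ p)"
    by (simp add: comm_proj_gen_pmap)
  also have "\<dots> = comm_proj ((gen x ^ (p ^ k)) ^ p)" by (rule comm_proj_power_cong[OF Suc])
  finally show ?case by (simp add: power_mult[symmetric] mult.commute)
qed simp

lemma comm_proj_linear_combination:
  "finite S \<Longrightarrow> comm_proj (\<Sum>i\<in>S. Poly_Mapping.single 0 (c i) * \<mu> i) =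
    (\<Oplus>\<^bsub>restricted_enveloping_algebra\<^esub>i\<in>S. c i \<odot>\<^bsub>restricted_enveloping_algebra\<^esub> comm_proj (\<mu> i))"
proof (induction S rule: finite_induct)
  case (insert i S)
  then show ?case
    by (subst A.module.M.finsum_insert) (auto simp: comm_proj_add comm_proj_smult)
qed (simp add: comm_proj_zero)

lemma comm_proj_lincomb:
  assumes "finite S" "\<And>b. b \<in> S \<Longrightarrow> comm_proj (\<beta> b) = b"
  shows "comm_proj (\<Sum>b\<in>S. Poly_Mapping.single 0 (c b) * \<beta> b) = A.lincomb c S"
proof -
  have S: "b \<in> carrier restricted_enveloping_algebra" if "b \<in> S" for b
    using assms(2)[OF that] by (metis comm_proj_closed)
  show ?thesis
    unfolding comm_proj_linear_combination[OF assms(1)] A.lincomb_def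
    by (rule A.module.M.finsum_cong') (auto simp: assms(2) S)
qed

lemma multiplicative_basis_imp_relations_liftable:
  assumes n: "n \<ge> 1" "\<And>x. (pmap ^^ n) x = 0"
    and B: "A.basis B"
    and mult: "\<And>b b'. b \<in> B \<Longrightarrow> b' \<in> B \<Longrightarrow>
      b \<otimes>\<^bsub>restricted_enveloping_algebra\<^esub> b' = \<zero>\<^bsub>restricted_enveloping_algebra\<^esub> \<or>
      b \<otimes>\<^bsub>restricted_enveloping_algebra\<^esub> b' \<in> B"
  shows "relations_liftable"
  unfolding relations_liftable_def
proof (intro allI impI)
  fix k x Y assume Y: "finite Y" "(pmap ^^ k) x \<in> span ((pmap ^^ k) ` Y)"
  let ?c = "Poly_Mapping.single (0 :: 'l multiset)"
  define q where "q = p ^ k"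
  have "q > 0" using p_pos by (simp add: q_def)
  have prime: "prime CHAR('f)" "prime CHAR('l multiset \<Rightarrow>\<^sub>0 'f)"
    using prime_p by (simp_all add: char_p CHAR_poly_mapping)
  have frob_sum: "sum g S ^ q = (\<Sum>i\<in>S. g i ^ q)" for g :: "'x \<Rightarrow> 'f" and S
    using freshmans_dream_sum'[OF prime(1), of q k g S] by (simp add: char_p q_def)
  from in_span_image_finite[OF Y] obtain d
    where d: "(pmap ^^ k) x = (\<Sum>y\<in>Y. scale (d y) ((pmap ^^ k) y))" by blast
  have B_span: "carrier restricted_enveloping_algebra = A.span B"
    and B_indep: "\<not> A.lin_dep B" and B_sub: "B \<subseteq> carrier restricted_enveloping_algebra"
    using B by (auto simp: A.basis_def)
  have "\<forall>b\<in>B. \<exists>g. comm_proj g = b"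
    using B_sub by (auto simp: carrier_eq_range_comm_proj)
  then obtain \<beta> where \<beta>: "\<And>b. b \<in> B \<Longrightarrow> comm_proj (\<beta> b) = b" by metis
  have indep: "c b = 0"
    if "finite S" "S \<subseteq> B" "comm_proj (\<Sum>b\<in>S. ?c (c b) * \<beta> b) = \<zero>\<^bsub>restricted_enveloping_algebra\<^esub>" "b \<in> S"
    for S c b
  proof -
    have "A.lincomb c S = \<zero>\<^bsub>restricted_enveloping_algebra\<^esub>"
      using that comm_proj_lincomb[of S \<beta> c] \<beta> by auto
    then show ?thesis using B_indep that unfolding A.lin_dep_def by auto
  qed
  define P where "P g S c \<longleftrightarrow> finite S \<and> S \<subseteq> B \<and>
    comm_proj g = comm_proj (\<Sum>b\<in>S. ?c (c b) * \<beta> b)" for g S c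
  have "\<exists>S c. P g S c" for g
  proof -
    have "comm_proj g \<in> A.span B" using B_span comm_proj_closed by blast
    then obtain c S where "comm_proj g = A.lincomb c S" "finite S" "S \<subseteq> B"
      unfolding A.span_def by blast
    then show ?thesis using comm_proj_lincomb[of S \<beta> c] \<beta>
      unfolding P_def by (intro exI[of _ S] exI[of _ c]) auto
  qed
  then have "\<forall>z. \<exists>S c. P (gen z) S c" by blast
  then obtain S c where "\<And>z. P (gen z) (S z) (c z)" by metis
  then have S: "\<And>z. finite (S z)" "\<And>z. S z \<subseteq> B"
    "\<And>z. comm_proj (gen z) = comm_proj (\<Sum>b\<in>S z. ?c (c z b) * \<beta> b)"
    unfolding P_def by blast+
  define N where "N = (\<Union>z\<in>insert x Y. S z)"
  have N: "finite N" "N \<subseteq> B" using S Y(1) by (auto simp: N_def)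
  define \<gamma> where "\<gamma> z b = (if b \<in> S z then c z b else 0)" for z b
  have \<gamma>: "comm_proj (gen z) = comm_proj (\<Sum>b\<in>N. ?c (\<gamma> z b) * \<beta> b)" if "z \<in> insert x Y" for z
  proof -
    have "(\<Sum>b\<in>S z. ?c (c z b) * \<beta> b) = (\<Sum>b\<in>N. ?c (\<gamma> z b) * \<beta> b)"
      using N(1) that by (intro sum.mono_neutral_cong_left) (auto simp: N_def \<gamma>_def)
    then show ?thesis using S(3) by simp
  qed
  define pw where "pw b = comm_proj (\<beta> b ^ q)" for b
  have pw: "pw b = \<zero>\<^bsub>restricted_enveloping_algebra\<^esub> \<or> pw b \<in> B" if "b \<in> B" for b
  proof -
    \<comment> \<open>Powers start with exponent 1, since the unit of u(L) is not assumed to lie in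
      \<open>B\<close>.\<close>
    have "comm_proj (\<beta> b ^ Suc m) = \<zero>\<^bsub>restricted_enveloping_algebra\<^esub> \<or> comm_proj (\<beta> b ^ Suc m) \<in> B" for m
    proof (induction m)
      case 0
      then show ?case using \<beta> that by simp
    next
      case (Suc m)
      have "comm_proj (\<beta> b ^ Suc (Suc m)) =
          b \<otimes>\<^bsub>restricted_enveloping_algebra\<^esub> comm_proj (\<beta> b ^ Suc m)"
        using \<beta>[OF that] comm_proj_mult[of "\<beta> b" "\<beta> b ^ Suc m"] by simp
      then show ?case using Suc mult[OF that, of "comm_proj (\<beta> b ^ Suc m)"] that B_sub by auto
    qed
    from this[of "q - 1"] show ?thesis using \<open>q > 0\<close> by (simp add: pw_def)
  qed
  define N' where "N' = pw ` N - {\<zero>\<^bsub>restricted_enveloping_algebra\<^esub>}"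
  have N': "finite N'" "N' \<subseteq> B" using N pw by (auto simp: N'_def)
  \<comment> \<open>Different elements of \<open>B\<close> may have the same \<open>q\<close>-th
    power, so their coordinates are collected. As Frobenius is additive, the sum of the
    \<open>\<gamma> z b ^ q\<close> is the \<open>q\<close>-th power of the sum, so the image of
    \<open>z\<close> again has \<open>q\<close>-th powers as coordinates.\<close>
  define \<Gamma> where "\<Gamma> z b' = (\<Sum>b | b \<in> N \<and> pw b = b'. \<gamma> z b)" for z b'
  have \<Gamma>: "comm_proj (gen ((pmap ^^ k) z)) = comm_proj (\<Sum>b'\<in>N'. ?c (\<Gamma> z b' ^ q) * \<beta> b')"
    if z: "z \<in> insert x Y" for z
  proof -
    let ?N = "{b \<in> N. pw b \<noteq> \<zero>\<^bsub>restricted_enveloping_algebra\<^esub>}"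
    let ?\<sigma> = "\<lambda>b. if pw b = \<zero>\<^bsub>restricted_enveloping_algebra\<^esub> then 0 else \<beta> (pw b)"
    have "comm_proj (gen ((pmap ^^ k) z)) = comm_proj ((\<Sum>b\<in>N. ?c (\<gamma> z b) * \<beta> b) ^ q)"
      unfolding comm_proj_gen_pow_pmap q_def by (rule comm_proj_power_cong[OF \<gamma>[OF z]])
    also have "(\<Sum>b\<in>N. ?c (\<gamma> z b) * \<beta> b) ^ q = (\<Sum>b\<in>N. ?c (\<gamma> z b ^ q) * \<beta> b ^ q)"
      using freshmans_dream_sum'[OF prime(2), of q k "\<lambda>b. ?c (\<gamma> z b) * \<beta> b" N]
      by (simp add: CHAR_poly_mapping char_p q_def power_mult_distrib single_power)
    also have "comm_proj \<dots> = comm_proj (\<Sum>b\<in>N. ?c (\<gamma> z b ^ q) * ?\<sigma> b)"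
    proof (intro comm_proj_sum_cong comm_proj_mult_cong refl)
      fix b assume "b \<in> N"
      then show "comm_proj (\<beta> b ^ q) = comm_proj (?\<sigma> b)"
        using pw[of b] N(2) \<beta>[of "pw b"] by (auto simp: comm_proj_zero pw_def)
    qed
    also have "(\<Sum>b\<in>N. ?c (\<gamma> z b ^ q) * ?\<sigma> b) = (\<Sum>b\<in>?N. ?c (\<gamma> z b ^ q) * \<beta> (pw b))"
      using N(1) by (intro sum.mono_neutral_cong_right) auto
    also have "\<dots> = (\<Sum>b'\<in>N'. \<Sum>b | b \<in> ?N \<and> pw b = b'. ?c (\<gamma> z b ^ q) * \<beta> (pw b))"
      using N(1) N'(1) by (intro sum.group[symmetric]) (auto simp: N'_def)
    also have "\<dots> = (\<Sum>b'\<in>N'. ?c (\<Gamma> z b' ^ q) * \<beta> b')"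
    proof (rule sum.cong[OF refl])
      fix b' assume b': "b' \<in> N'"
      have "(\<Sum>b | b \<in> ?N \<and> pw b = b'. ?c (\<gamma> z b ^ q) * \<beta> (pw b)) =
          (\<Sum>b | b \<in> N \<and> pw b = b'. ?c (\<gamma> z b ^ q) * \<beta> b')"
        using b' by (intro sum.cong) (auto simp: N'_def)
      also have "\<dots> = ?c (\<Sum>b | b \<in> N \<and> pw b = b'. \<gamma> z b ^ q) * \<beta> b'"
        unfolding sum_distrib_right[symmetric]
        by (simp add: single_sum)
      finally show "(\<Sum>b | b \<in> ?N \<and> pw b = b'. ?c (\<gamma> z b ^ q) * \<beta> (pw b)) = ?c (\<Gamma> z b' ^ q) * \<beta> b'"
        by (simp add: \<Gamma>_def frob_sum)
    qed
    finally show ?thesis .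
  qed
  have comb: "comm_proj (gen (\<Sum>y\<in>Y. scale (a y) ((pmap ^^ k) y))) =
      comm_proj (\<Sum>b'\<in>N'. ?c (\<Sum>y\<in>Y. a y * \<Gamma> y b' ^ q) * \<beta> b')" for a
  proof -
    have "comm_proj (gen (\<Sum>y\<in>Y. scale (a y) ((pmap ^^ k) y))) =
        comm_proj (\<Sum>y\<in>Y. ?c (a y) * (\<Sum>b'\<in>N'. ?c (\<Gamma> y b' ^ q) * \<beta> b'))"
      unfolding comm_proj_gen_sum using \<Gamma>
      by (intro comm_proj_sum_cong comm_proj_mult_cong refl) auto
    also have "(\<Sum>y\<in>Y. ?c (a y) * (\<Sum>b'\<in>N'. ?c (\<Gamma> y b' ^ q) * \<beta> b')) =
        (\<Sum>b'\<in>N'. \<Sum>y\<in>Y. ?c (a y) * (?c (\<Gamma> y b' ^ q) * \<beta> b'))"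
      unfolding sum_distrib_left by (rule sum.swap)
    also have "\<dots> = (\<Sum>b'\<in>N'. ?c (\<Sum>y\<in>Y. a y * \<Gamma> y b' ^ q) * \<beta> b')"
      by (simp add: single_sum sum_distrib_right mult_single mult.assoc[symmetric])
    finally show ?thesis .
  qed
  have eq: "\<Gamma> x b' ^ q = (\<Sum>y\<in>Y. d y * \<Gamma> y b' ^ q)" if "b' \<in> N'" for b'
  proof -
    have "comm_proj (\<Sum>b'\<in>N'. ?c (\<Gamma> x b' ^ q) * \<beta> b') =
        comm_proj (\<Sum>b'\<in>N'. ?c (\<Sum>y\<in>Y. d y * \<Gamma> y b' ^ q) * \<beta> b')"
      using \<Gamma>[of x] comb[of d] d by simp
    then have "comm_proj (\<Sum>b'\<in>N'. ?c (\<Gamma> x b' ^ q - (\<Sum>y\<in>Y. d y * \<Gamma> y b' ^ q)) * \<beta> b') =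
        \<zero>\<^bsub>restricted_enveloping_algebra\<^esub>"
      by (simp add: comm_proj_eq_iff sum_subtractf single_diff left_diff_distrib)
    from indep[OF N' this that] show ?thesis by simp
  qed
  have q_char: "q = CHAR('f) ^ k" by (simp add: q_def char_p)
  \<comment> \<open>The \<open>d y\<close> need not be \<open>q\<close>-th powers; removing
    Frobenius from the coordinate equations gives scalars \<open>d'\<close> whose
    \<open>q\<close>-th powers satisfy the same equations.\<close>
  obtain d' where d': "\<forall>b'\<in>N'. \<Gamma> x b' = (\<Sum>y\<in>Y. d' y * \<Gamma> y b')"
    using frobenius_linear_combination[OF prime(1) q_char Y(1), of N' "\<Gamma> x" d \<Gamma>] eq by blast
  define y where "y = (\<Sum>y\<in>Y. scale (d' y) y)"
  have "(pmap ^^ k) y = (\<Sum>y\<in>Y. scale (d' y ^ q) ((pmap ^^ k) y))"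
    by (simp add: y_def pow_pmap_sum pow_pmap_scale q_def)
  then have "comm_proj (gen ((pmap ^^ k) y)) =
      comm_proj (\<Sum>b'\<in>N'. ?c (\<Sum>y\<in>Y. d' y ^ q * \<Gamma> y b' ^ q) * \<beta> b')"
    using comb[of "\<lambda>y. d' y ^ q"] by simp
  also have "(\<Sum>b'\<in>N'. ?c (\<Sum>y\<in>Y. d' y ^ q * \<Gamma> y b' ^ q) * \<beta> b') =
      (\<Sum>b'\<in>N'. ?c (\<Gamma> x b' ^ q) * \<beta> b')"
    using d' by (intro sum.cong) (simp_all add: frob_sum power_mult_distrib)
  also have "comm_proj \<dots> = comm_proj (gen ((pmap ^^ k) x))" by (simp add: \<Gamma>)
  finally have "comm_proj (gen ((pmap ^^ k) x - (pmap ^^ k) y)) = \<zero>\<^bsub>restricted_enveloping_algebra\<^esub>"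
    by (simp add: comm_proj_gen_diff comm_proj_eq_iff[symmetric])
  \<comment> \<open>So far the equality holds in u(L); the embedding of L brings it back.\<close>
  then have "(pmap ^^ k) x - (pmap ^^ k) y = 0" by (rule comm_proj_gen_eq_zeroD[OF n])
  moreover have "y \<in> span Y" unfolding y_def by (intro span_sum span_scale span_base)
  ultimately show "\<exists>y\<in>span Y. (pmap ^^ k) x = (pmap ^^ k) y" by auto
qed

end

section \<open>The monomial basis\<close>

lemma prod_mset_single: "(\<Prod>i\<in>#M. Poly_Mapping.single {#i#} 1) = Poly_Mapping.single M (1::'f::comm_ring_1)"
  by (induction M) (simp_all add: mult_single)

lemma sum_singleton_mset: "(\<Sum>j<n. {#i#}) = replicate_mset n i"
  by (induction n) simp_all

text \<open>A sum of multisets is empty only if both are, so taking the constant term is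
  multiplicative.\<close>

lemma lookup_mult_empty:
  "Poly_Mapping.lookup (r * s) {#} = Poly_Mapping.lookup r {#} * Poly_Mapping.lookup s {#}"
  for r s :: "'i multiset \<Rightarrow>\<^sub>0 'f::comm_ring_1"
proof (induction r rule: poly_mapping_add_induct)
  case (single M c)
  show ?case
  proof (induction s rule: poly_mapping_add_induct)
    case (single N d)
    then show ?case by (simp add: mult_single lookup_single when_def)
  qed (simp add: lookup_add distrib_left)
qed (simp add: lookup_add distrib_right)

context abelian_restricted_lie_algebra
begin

interpretation A: assoc_algebra class_ring restricted_enveloping_algebra
  by (rule assoc_algebra_restricted_enveloping_algebra)

lemma comm_proj_gen_setsum: "comm_proj (gen (sum f S)) = comm_proj (\<Sum>i\<in>S. gen (f i))"
  using comm_proj_gen_sum[of "\<lambda>_. 1" f S] by simp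

lemma comm_proj_uminus:
  "\<ominus>\<^bsub>restricted_enveloping_algebra\<^esub> comm_proj g = comm_proj (- g)"
  by (rule A.module.M.minus_equality) (simp_all add: comm_proj_add[symmetric] comm_proj_zero)

context
  fixes I :: "'i set" and h :: "'i \<Rightarrow> 'l" and e :: "'i \<Rightarrow> nat"
  assumes basis: "chain_basis I h e"
    and outside: "\<And>i. i \<notin> I \<Longrightarrow> h i = 0" "\<And>i. i \<notin> I \<Longrightarrow> e i = 0"
begin

text \<open>Outside \<open>I\<close> the bound is \<open>p ^ 0 = 1\<close>, so these multisets are
  supported on \<open>I\<close>.\<close>

definition exponents :: "'i multiset set" where
  "exponents = {M. \<forall>i. count M i < p ^ e i}"

definition gen_prod :: "'i multiset \<Rightarrow> 'l multiset \<Rightarrow>\<^sub>0 'f" where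
  "gen_prod M = (\<Prod>i\<in>#M. gen (h i))"

definition subst :: "('i multiset \<Rightarrow>\<^sub>0 'f) \<Rightarrow> 'l multiset \<Rightarrow>\<^sub>0 'f" where
  "subst = poly_mapping_eval (Poly_Mapping.single 0) gen_prod"

lemma pow_pmap_chain_zero: "(pmap ^^ e i) (h i) = 0"
  using chain_basis_zero[OF basis] outside by (cases "i \<in> I") auto

lemma gen_prod_add: "gen_prod (M + N) = gen_prod M * gen_prod N"
  by (simp add: gen_prod_def)

lemma gen_prod_empty: "gen_prod {#} = 1"
  by (simp add: gen_prod_def)

lemma gen_prod_replicate: "gen_prod (replicate_mset n i) = gen (h i) ^ n"
  by (simp add: gen_prod_def)

lemma subst_add: "subst (r + s) = subst r + subst s"
  unfolding subst_def by (rule poly_mapping_eval_add) (rule single_add)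

lemma subst_sum: "subst (sum f S) = (\<Sum>i\<in>S. subst (f i))"
  unfolding subst_def by (rule poly_mapping_eval_sum) (rule single_add)

lemma subst_single: "subst (Poly_Mapping.single M c) = Poly_Mapping.single 0 c * gen_prod M"
  unfolding subst_def by (rule poly_mapping_eval_single) (rule single_add)

lemma subst_mult: "subst (r * s) = subst r * subst s"
  unfolding subst_def
  by (rule poly_mapping_eval_mult) (simp_all add: single_add mult_single gen_prod_add gen_prod_empty)

lemma comm_proj_gen_nilpotent:
  "comm_proj (gen (h i) ^ (p ^ e i)) = \<zero>\<^bsub>restricted_enveloping_algebra\<^esub>"
  using comm_proj_gen_pow_pmap[of "e i" "h i"] by (simp add: pow_pmap_chain_zero comm_proj_gen_zero)

lemma comm_proj_mult_eq_zero:
  "comm_proj f = \<zero>\<^bsub>restricted_enveloping_algebra\<^esub> \<Longrightarrow>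
    comm_proj (f * g) = \<zero>\<^bsub>restricted_enveloping_algebra\<^esub>"
  by (simp add: comm_proj_mult)

lemma comm_proj_gen_prod_eq_zero:
  assumes "M \<notin> exponents"
  shows "comm_proj (gen_prod M) = \<zero>\<^bsub>restricted_enveloping_algebra\<^esub>"
proof -
  obtain i where "p ^ e i \<le> count M i" using assms by (auto simp: exponents_def not_less)
  then have "replicate_mset (p ^ e i) i \<subseteq># M" by (simp add: count_le_replicate_mset_subset_eq)
  then have "M = replicate_mset (p ^ e i) i + (M - replicate_mset (p ^ e i) i)" by simp
  then have "gen_prod M = gen (h i) ^ (p ^ e i) * gen_prod (M - replicate_mset (p ^ e i) i)"
    by (metis gen_prod_add gen_prod_replicate)
  then show ?thesis by (simp add: comm_proj_mult_eq_zero[OF comm_proj_gen_nilpotent])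
qed

lemma comm_proj_gen_chain_comb:
  "comm_proj (gen (chain_comb I h e c)) =
    comm_proj (subst (\<Sum>i\<in>I. \<Sum>k<e i. Poly_Mapping.single (replicate_mset (p ^ k) i) (c i k)))"
proof -
  have "comm_proj (gen (chain_comb I h e c)) =
      comm_proj (\<Sum>i\<in>I. \<Sum>k<e i. Poly_Mapping.single 0 (c i k) * gen ((pmap ^^ k) (h i)))"
    unfolding chain_comb_def comm_proj_gen_setsum
    by (rule comm_proj_sum_cong) (rule comm_proj_gen_sum)
  also have "\<dots> = comm_proj (\<Sum>i\<in>I. \<Sum>k<e i. Poly_Mapping.single 0 (c i k) * gen (h i) ^ (p ^ k))"
    by (intro comm_proj_sum_cong comm_proj_mult_cong refl comm_proj_gen_pow_pmap)
  finally show ?thesis by (simp add: subst_sum subst_single gen_prod_replicate)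
qed

text \<open>The letters of a monomial are replaced one at a time by their expansion in the chain
  basis, where the element of height \<open>k\<close> in a chain becomes the \<open>p ^ k\<close>-th
  power of its head.\<close>

lemma subst_surj: "\<exists>r. comm_proj g = comm_proj (subst r)"
proof (induction g rule: poly_mapping_add_induct)
  case (single M c)
  show ?case
  proof (induction M)
    case empty
    have "comm_proj (Poly_Mapping.single {#} c) = comm_proj (subst (Poly_Mapping.single {#} c))"
      by (simp add: subst_single gen_prod_empty)
    then show ?case by (rule exI)
  next
    case (add x M)
    then obtain r where r: "comm_proj (Poly_Mapping.single M c) = comm_proj (subst r)" by blast
    obtain d where d: "x = chain_comb I h e d" using chain_basis_span[OF basis] by blast
    let ?s = "\<Sum>i\<in>I. \<Sum>k<e i. Poly_Mapping.single (replicate_mset (p ^ k) i) (d i k)"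
    have "comm_proj (Poly_Mapping.single (add_mset x M) c) = comm_proj (gen x * Poly_Mapping.single M c)"
      by (simp add: gen_def mult_single)
    also have "\<dots> = comm_proj (subst ?s * subst r)"
      by (rule comm_proj_mult_cong[OF _ r]) (simp only: d comm_proj_gen_chain_comb)
    also have "\<dots> = comm_proj (subst (?s * r))" by (simp only: subst_mult)
    finally show ?case by (rule exI)
  qed
next
  case (add f g)
  then obtain r s where "comm_proj f = comm_proj (subst r)" "comm_proj g = comm_proj (subst s)" by blast
  then have "comm_proj (f + g) = comm_proj (subst (r + s))" by (simp add: comm_proj_add subst_add)
  then show ?case by (rule exI)
qed

lemma comm_proj_subst:
  "comm_proj (subst r) = comm_proj (\<Sum>M\<in>Poly_Mapping.keys r \<inter> exponents.
    Poly_Mapping.single 0 (Poly_Mapping.lookup r M) * gen_prod M)"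
proof -
  have "comm_proj (subst r) = comm_proj (\<Sum>M\<in>Poly_Mapping.keys r.
      Poly_Mapping.single 0 (Poly_Mapping.lookup r M) * (if M \<in> exponents then gen_prod M else 0))"
    unfolding subst_def poly_mapping_eval_def
    by (intro comm_proj_sum_cong comm_proj_mult_cong refl)
      (simp add: comm_proj_gen_prod_eq_zero comm_proj_zero)
  also have "(\<Sum>M\<in>Poly_Mapping.keys r.
      Poly_Mapping.single 0 (Poly_Mapping.lookup r M) * (if M \<in> exponents then gen_prod M else 0)) =
      (\<Sum>M\<in>Poly_Mapping.keys r \<inter> exponents. Poly_Mapping.single 0 (Poly_Mapping.lookup r M) * gen_prod M)"
    by (rule sum.mono_neutral_cong_right) auto
  finally show ?thesis .
qed

text \<open>The test map sends the element of height \<open>k\<close> in chain \<open>i\<close> to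
  \<open>Z i ^ (p ^ k)\<close> and is extended linearly; the ideal consists of the polynomials
  without monomials in \<open>exponents\<close>. Monomials in the heads go to the same monomials in
  the variables, where coefficients can be read off.\<close>

lemma gen_prod_independent:
  assumes S: "finite S" "S \<subseteq> exponents"
    and zero: "comm_proj (\<Sum>M\<in>S. Poly_Mapping.single 0 (c M) * gen_prod M) =
      \<zero>\<^bsub>restricted_enveloping_algebra\<^esub>"
    and M: "M \<in> S"
  shows "c M = 0"
proof -
  have fin: "finite I" by (rule chain_basis_finite[OF basis])
  obtain coef where coef: "\<And>x. x = chain_comb I h e (coef x)"
    using chain_basis_span[OF basis] by metis
  have coef_unique: "coef x i k = c i k" if "x = chain_comb I h e c" "i \<in> I" "k < e i" for x c i k
    using chain_basis_indep[OF basis, of "\<lambda>i k. coef x i k - c i k" i k] coef[of x] that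
    by (simp add: chain_comb_diff[symmetric])
  define Z :: "'i \<Rightarrow> 'i multiset \<Rightarrow>\<^sub>0 'f" where "Z i = Poly_Mapping.single {#i#} 1" for i
  define \<theta> where "\<theta> x = (\<Sum>i\<in>I. \<Sum>k<e i. Poly_Mapping.single 0 (coef x i k) * Z i ^ (p ^ k))" for x
  let ?c = "Poly_Mapping.single (0 :: 'i multiset) :: 'f \<Rightarrow> _"
  let ?I = "{g :: 'i multiset \<Rightarrow>\<^sub>0 'f. \<forall>M\<in>exponents. Poly_Mapping.lookup g M = 0}"
  have I_add: "f + g \<in> ?I" if "f \<in> ?I" "g \<in> ?I" for f g using that by (simp add: lookup_add)
  \<comment> \<open>Sub-multisets of members of \<open>exponents\<close> are again in
    \<open>exponents\<close>, so multiplication cannot create such a monomial from monomials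
    outside.\<close>
  have I_mult: "g * f \<in> ?I" if "f \<in> ?I" for f g
  proof -
    have "Poly_Mapping.keys (g * f) \<inter> exponents = {}"
    proof (rule equals0I)
      fix M assume "M \<in> Poly_Mapping.keys (g * f) \<inter> exponents"
      then obtain A B where AB: "M = A + B" "B \<in> Poly_Mapping.keys f" "M \<in> exponents"
        using keys_mult[of g f] by auto
      have "count B i < p ^ e i" for i
        using AB(1,3) by (auto simp: exponents_def intro: le_less_trans[of "count B i" "count M i"])
      then have "B \<in> exponents" by (simp add: exponents_def)
      then show False using that AB(2) by (auto simp: in_keys_iff)
    qed
    then show ?thesis by (auto simp: in_keys_iff)
  qed
  have theta_add: "\<theta> (x + y) = \<theta> x + \<theta> y" for x y
  proof -
    have "x + y = chain_comb I h e (\<lambda>i k. coef x i k + coef y i k)"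
      unfolding chain_comb_add[symmetric] using coef by metis
    then have "coef (x + y) i k = coef x i k + coef y i k" if "i \<in> I" "k < e i" for i k
      using coef_unique that by blast
    then show ?thesis
      by (simp add: \<theta>_def single_add distrib_right sum.distrib)
  qed
  have theta_scale: "\<theta> (scale a x) = ?c a * \<theta> x" for a x
  proof -
    have "scale a x = chain_comb I h e (\<lambda>i k. a * coef x i k)"
      unfolding chain_comb_scale[symmetric] using coef by metis
    then have "coef (scale a x) i k = a * coef x i k" if "i \<in> I" "k < e i" for i k
      using coef_unique that by blast
    then show ?thesis
      by (simp add: \<theta>_def sum_distrib_left mult.assoc[symmetric] mult_single)
  qed
  have theta_zero: "\<theta> 0 = 0" using theta_scale[of 0 0] by simp
  have theta_chain: "\<theta> ((pmap ^^ k) (h i)) = Z i ^ (p ^ k)" if ik: "i \<in> I" "k < e i" for i k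
  proof -
    have "coef ((pmap ^^ k) (h i)) j l = (if j = i \<and> l = k then 1 else 0)" if "j \<in> I" "l < e j" for j l
      using coef_unique[OF chain_comb_delta[OF fin ik(1), of k e h, OF ik(2), symmetric] that] .
    then have "\<theta> ((pmap ^^ k) (h i)) =
        (\<Sum>j\<in>I. \<Sum>l<e j. ?c (if j = i \<and> l = k then 1 else 0) * Z j ^ (p ^ l))"
      by (simp add: \<theta>_def)
    also have "\<dots> = (\<Sum>j\<in>I. if j = i then Z i ^ (p ^ k) else 0)"
    proof (rule sum.cong[OF refl])
      fix j assume "j \<in> I"
      show "(\<Sum>l<e j. ?c (if j = i \<and> l = k then 1 else 0) * Z j ^ (p ^ l)) =
          (if j = i then Z i ^ (p ^ k) else 0)"
      proof (cases "j = i")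
        case j: True
        have "(\<Sum>l<e j. ?c (if j = i \<and> l = k then 1 else 0) * Z j ^ (p ^ l)) =
            (\<Sum>l<e i. if l = k then Z i ^ (p ^ k) else 0)"
          by (rule sum.cong) (simp_all add: j)
        also have "\<dots> = Z i ^ (p ^ k)" using ik(2) by (subst sum.delta) simp_all
        finally show ?thesis by (simp only: j simp_thms if_True)
      qed simp
    qed
    also have "\<dots> = Z i ^ (p ^ k)" using fin ik(1) by (subst sum.delta) simp_all
    finally show ?thesis .
  qed
  have prime: "prime CHAR('i multiset \<Rightarrow>\<^sub>0 'f)" "p = CHAR('i multiset \<Rightarrow>\<^sub>0 'f)"
    using prime_p by (simp_all add: CHAR_poly_mapping char_p)
  \<comment> \<open>Compatibility with the \<open>p\<close>-map defines a subspace, since both sides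
    are additive and scale by \<open>a ^ p\<close>; hence checking chain elements suffices.\<close>
  let ?G = "{x. \<theta> x ^ p - \<theta> (pmap x) \<in> ?I}"
  have "subspace ?G"
  proof (rule subspaceI)
    show "0 \<in> ?G" using p_pos by (simp add: theta_zero pmap_zero zero_power)
    show "x + y \<in> ?G" if "x \<in> ?G" "y \<in> ?G" for x y
    proof -
      have "\<theta> (x + y) ^ p - \<theta> (pmap (x + y)) =
          (\<theta> x ^ p - \<theta> (pmap x)) + (\<theta> y ^ p - \<theta> (pmap y))"
        by (simp add: theta_add pmap_additive freshmans_dream[OF prime])
      then show ?thesis using I_add that by (simp only: mem_Collect_eq)
    qed
    show "scale a x \<in> ?G" if "x \<in> ?G" for a x
    proof -
      have "\<theta> (scale a x) ^ p - \<theta> (pmap (scale a x)) = ?c (a ^ p) * (\<theta> x ^ p - \<theta> (pmap x))"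
        by (simp add: theta_scale pmap_scale power_mult_distrib single_power right_diff_distrib)
      then show ?thesis using I_mult that by (simp only: mem_Collect_eq)
    qed
  qed
  moreover have "(pmap ^^ k) (h i) \<in> ?G" if ik: "i \<in> I" "k < e i" for i k
  proof (cases "Suc k < e i")
    case True
    have "\<theta> ((pmap ^^ k) (h i)) ^ p = \<theta> ((pmap ^^ Suc k) (h i))"
      unfolding theta_chain[OF ik] theta_chain[OF ik(1) True]
      by (simp add: power_mult[symmetric] mult.commute)
    then show ?thesis by simp
  next
    case False
    \<comment> \<open>At the end of a chain the \<open>p\<close>-map gives \<open>0\<close>, while
      the \<open>p\<close>-th power is \<open>Z i ^ (p ^ e i)\<close>, the first power of
      \<open>Z i\<close> in the ideal.\<close>
    then have k: "Suc k = e i" using ik by simp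
    have "pmap ((pmap ^^ k) (h i)) = 0" using pow_pmap_chain_zero[of i] k[symmetric] by simp
    moreover have "\<theta> ((pmap ^^ k) (h i)) ^ p = Poly_Mapping.single (replicate_mset (p ^ e i) i) 1"
    proof -
      have "\<theta> ((pmap ^^ k) (h i)) ^ p = Z i ^ (p ^ e i)"
        unfolding theta_chain[OF ik] k[symmetric] by (simp add: power_mult[symmetric] mult.commute)
      then show ?thesis by (simp add: Z_def single_power sum_singleton_mset)
    qed
    moreover have "replicate_mset (p ^ e i) i \<notin> exponents" by (auto simp: exponents_def)
    ultimately show ?thesis by (auto simp: theta_zero lookup_single when_def)
  qed
  ultimately have chain_comb_G: "chain_comb I h e d \<in> ?G" for d
    unfolding chain_comb_def by (intro subspace_sum subspace_scale) auto
  have "x \<in> ?G" for x by (subst coef[of x]) (rule chain_comb_G)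
  then have pow: "\<theta> x ^ p - \<theta> (pmap x) \<in> ?I" for x by (simp only: mem_Collect_eq)
  have ev: "poly_mapping_eval ?c (\<lambda>M. \<Prod>x\<in>#M. \<theta> x) (\<Sum>M\<in>S. Poly_Mapping.single 0 (c M) * gen_prod M) \<in> ?I"
    by (rule comm_proj_eq_zero_imp_mem[where \<phi> = ?c and \<theta> = \<theta> and I = ?I,
          OF _ _ _ I_add I_mult _ _ pow zero])
      (simp_all add: single_add mult_single theta_add theta_scale)
  have ev_mult: "poly_mapping_eval ?c (\<lambda>M. \<Prod>x\<in>#M. \<theta> x) (f * g) =
      poly_mapping_eval ?c (\<lambda>M. \<Prod>x\<in>#M. \<theta> x) f * poly_mapping_eval ?c (\<lambda>M. \<Prod>x\<in>#M. \<theta> x) g" for f g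
    by (rule poly_mapping_eval_mult) (simp_all add: single_add mult_single)
  have ev_single: "poly_mapping_eval ?c (\<lambda>M. \<Prod>x\<in>#M. \<theta> x) (Poly_Mapping.single M a) =
      ?c a * (\<Prod>x\<in>#M. \<theta> x)" for M a
    by (rule poly_mapping_eval_single) (rule single_add)
  have ev_one: "poly_mapping_eval ?c (\<lambda>M. \<Prod>x\<in>#M. \<theta> x) 1 = 1"
    using ev_single[of 0 1] by simp
  have ev_gen_prod: "poly_mapping_eval ?c (\<lambda>M. \<Prod>x\<in>#M. \<theta> x) (gen_prod M) = (\<Prod>i\<in>#M. \<theta> (h i))" for M
    by (induction M) (simp_all add: gen_prod_def ev_one ev_mult gen_def ev_single)
  have theta_prod: "(\<Prod>i\<in>#M. \<theta> (h i)) = Poly_Mapping.single M 1" if "M \<in> exponents" for M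
  proof -
    have "\<theta> (h i) = Poly_Mapping.single {#i#} 1" if "i \<in># M" for i
    proof -
      \<comment> \<open>A letter of \<open>M\<close> satisfies
        \<open>1 \<le> count M i < p ^ e i\<close>, which forces a positive chain length and hence
        \<open>i \<in> I\<close>.\<close>
      have "count M i \<ge> 1" using that by (simp add: Suc_leI)
      moreover have "count M i < p ^ e i" using \<open>M \<in> exponents\<close> by (simp add: exponents_def)
      ultimately have "e i > 0" by (cases "e i") (auto simp: count_eq_zero_iff)
      then have "i \<in> I" using outside(2) by (cases "i \<in> I") auto
      from theta_chain[OF this \<open>e i > 0\<close>] show ?thesis by (simp add: Z_def)
    qed
    then have "(\<Prod>i\<in>#M. \<theta> (h i)) = (\<Prod>i\<in>#M. Poly_Mapping.single {#i#} 1)"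
      by (intro arg_cong[of _ _ prod_mset] image_mset_cong)
    then show ?thesis by (simp add: prod_mset_single)
  qed
  have "poly_mapping_eval ?c (\<lambda>M. \<Prod>x\<in>#M. \<theta> x) (\<Sum>M\<in>S. Poly_Mapping.single 0 (c M) * gen_prod M) =
      (\<Sum>M\<in>S. Poly_Mapping.single M (c M))"
    unfolding poly_mapping_eval_sum[OF single_add]
  proof (rule sum.cong[OF refl])
    fix M assume "M \<in> S"
    then have "M \<in> exponents" using S(2) by blast
    then show "poly_mapping_eval ?c (\<lambda>M. \<Prod>x\<in>#M. \<theta> x) (Poly_Mapping.single 0 (c M) * gen_prod M) =
        Poly_Mapping.single M (c M)"
      by (simp add: ev_mult ev_single ev_gen_prod theta_prod mult_single)
  qed
  then have "Poly_Mapping.lookup (\<Sum>M\<in>S. Poly_Mapping.single M (c M)) M = 0"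
    using ev M S(2) by auto
  moreover have "Poly_Mapping.lookup (\<Sum>M\<in>S. Poly_Mapping.single M (c M)) M = (\<Sum>N\<in>S. if N = M then c M else 0)"
    unfolding lookup_sum by (intro sum.cong) (auto simp: lookup_single when_def)
  ultimately show ?thesis using S(1) M by simp
qed

definition monomial :: "'i multiset \<Rightarrow> ('l free_monoid \<Rightarrow>\<^sub>0 'f) set set" where
  "monomial M = comm_proj (gen_prod M)"

text \<open>A basis is a set, so sums over exponents are linear combinations of distinct elements
  only by injectivity. Two equal monomials would give a relation with coefficients \<open>1\<close>
  and \<open>- 1\<close>.\<close>

lemma inj_on_monomial: "inj_on monomial exponents"
proof (rule inj_onI, rule ccontr)
  fix M N assume M: "M \<in> exponents" and N: "N \<in> exponents" "monomial M = monomial N" "M \<noteq> N"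
  let ?c = "\<lambda>K. if K = M then 1 else - 1 :: 'f"
  have "(\<Sum>K\<in>{M, N}. Poly_Mapping.single 0 (?c K) * gen_prod K) = gen_prod M - gen_prod N"
    using N(3) by (simp add: single_uminus)
  moreover have "comm_proj (gen_prod M - gen_prod N) = \<zero>\<^bsub>restricted_enveloping_algebra\<^esub>"
    using N(2) by (simp add: comm_proj_eq_iff monomial_def)
  ultimately have "?c M = 0"
    using M N by (intro gen_prod_independent[of "{M, N}" ?c M]) simp_all
  then show False by simp
qed

lemma lincomb_monomial:
  assumes "finite S" "S \<subseteq> exponents"
  shows "A.lincomb a (monomial ` S) =
    comm_proj (\<Sum>M\<in>S. Poly_Mapping.single 0 (a (monomial M)) * gen_prod M)"
proof -
  let ?\<beta> = "\<lambda>b. gen_prod (inv_into exponents monomial b)"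
  have inv: "inv_into exponents monomial (monomial M) = M" if "M \<in> S" for M
    using that assms(2) inj_on_monomial by (auto intro: inv_into_f_f)
  have "A.lincomb a (monomial ` S) = comm_proj (\<Sum>b\<in>monomial ` S. Poly_Mapping.single 0 (a b) * ?\<beta> b)"
    using assms(1) inv by (intro comm_proj_lincomb[symmetric]) (auto simp: monomial_def)
  also have "(\<Sum>b\<in>monomial ` S. Poly_Mapping.single 0 (a b) * ?\<beta> b) =
      (\<Sum>M\<in>S. Poly_Mapping.single 0 (a (monomial M)) * gen_prod M)"
    using inj_on_subset[OF inj_on_monomial assms(2)]
    by (subst sum.reindex) (simp_all add: inv)
  finally show ?thesis .
qed

lemma monomials_independent:
  assumes "T \<subseteq> exponents"
  shows "\<not> A.lin_dep (monomial ` T)"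
proof
  assume "A.lin_dep (monomial ` T)"
  then obtain S' a v where S': "finite S'" "S' \<subseteq> monomial ` T" "v \<in> S'" "a v \<noteq> 0"
    "A.lincomb a S' = \<zero>\<^bsub>restricted_enveloping_algebra\<^esub>"
    unfolding A.lin_dep_def by auto
  obtain S where S: "S \<subseteq> T" "finite S" "S' = monomial ` S"
    using finite_subset_image[OF S'(1,2)] by blast
  obtain M where M: "M \<in> S" "v = monomial M" using S'(3) S(3) by blast
  have "a (monomial M) = 0"
    using gen_prod_independent[of S "\<lambda>M. a (monomial M)" M] lincomb_monomial[of S a] S S'(5) M(1) assms
    by auto
  then show False using S'(4) M(2) by simp
qed

lemma in_span_monomials:
  assumes "finite S" "S \<subseteq> T" "T \<subseteq> exponents"
  shows "comm_proj (\<Sum>M\<in>S. Poly_Mapping.single 0 (c M) * gen_prod M) \<in> A.span (monomial ` T)"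
proof -
  have inv: "inv_into exponents monomial (monomial M) = M" if "M \<in> S" for M
    using that assms inj_on_monomial by (auto intro: inv_into_f_f)
  have "A.lincomb (\<lambda>b. c (inv_into exponents monomial b)) (monomial ` S) =
      comm_proj (\<Sum>M\<in>S. Poly_Mapping.single 0 (c M) * gen_prod M)"
    using assms by (subst lincomb_monomial) (auto simp: inv)
  then show ?thesis
    unfolding A.span_def using assms
    by (intro CollectI exI[of _ "\<lambda>b. c (inv_into exponents monomial b)"] exI[of _ "monomial ` S"]) auto
qed

lemma monomials_subset_carrier: "monomial ` T \<subseteq> carrier restricted_enveloping_algebra"
  by (auto simp: monomial_def)

lemma basis_monomials: "A.basis (monomial ` exponents)"
proof -
  have "comm_proj g \<in> A.span (monomial ` exponents)" for g
  proof -
    obtain r where "comm_proj g = comm_proj (subst r)" using subst_surj by blast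
    then show ?thesis unfolding comm_proj_subst using in_span_monomials by simp
  qed
  then have "A.span (monomial ` exponents) = carrier restricted_enveloping_algebra"
    using A.span_is_subset2[OF monomials_subset_carrier] by (auto simp: carrier_eq_range_comm_proj)
  then show ?thesis
    using monomials_independent[of exponents] monomials_subset_carrier by (simp add: A.basis_def)
qed

lemma monomial_mult:
  "monomial M \<otimes>\<^bsub>restricted_enveloping_algebra\<^esub> monomial N = \<zero>\<^bsub>restricted_enveloping_algebra\<^esub> \<or>
    monomial M \<otimes>\<^bsub>restricted_enveloping_algebra\<^esub> monomial N \<in> monomial ` exponents"
proof -
  have "monomial M \<otimes>\<^bsub>restricted_enveloping_algebra\<^esub> monomial N = monomial (M + N)"
    by (simp add: monomial_def gen_prod_add comm_proj_mult)
  then show ?thesis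
    using comm_proj_gen_prod_eq_zero[of "M + N"] by (auto simp: monomial_def)
qed

section \<open>The Jacobson radical of u(L)\<close>

lemma left_ideal_preimage:
  assumes "left_ideal J restricted_enveloping_algebra"
  shows "comm_proj 0 \<in> J"
    and "comm_proj f \<in> J \<Longrightarrow> comm_proj g \<in> J \<Longrightarrow> comm_proj (f + g) \<in> J"
    and "comm_proj f \<in> J \<Longrightarrow> comm_proj (g * f) \<in> J"
    and "J \<subseteq> carrier restricted_enveloping_algebra"
proof -
  interpret J: additive_subgroup J restricted_enveloping_algebra
    using assms by (simp add: left_ideal_def)
  show "comm_proj 0 \<in> J" by (simp add: comm_proj_zero)
  show "comm_proj f \<in> J \<Longrightarrow> comm_proj g \<in> J \<Longrightarrow> comm_proj (f + g) \<in> J"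
    by (simp add: comm_proj_add)
  show "comm_proj f \<in> J \<Longrightarrow> comm_proj (g * f) \<in> J"
    using assms by (simp add: comm_proj_mult left_ideal_def)
  show "J \<subseteq> carrier restricted_enveloping_algebra" by (rule J.a_subset)
qed

lemma left_ideal_image:
  assumes "0 \<in> X" "\<And>f g. f \<in> X \<Longrightarrow> g \<in> X \<Longrightarrow> f + g \<in> X" "\<And>f g. f \<in> X \<Longrightarrow> g * f \<in> X"
  shows "left_ideal (comm_proj ` X) restricted_enveloping_algebra"
proof -
  have neg: "- f \<in> X" if "f \<in> X" for f using assms(3)[OF that, of "- 1"] by simp
  have "subgroup (comm_proj ` X) (add_monoid restricted_enveloping_algebra)"
  proof (rule A.module.M.add.subgroupI)
    show "comm_proj ` X \<noteq> {}" using assms(1) by auto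
    show "\<ominus>\<^bsub>restricted_enveloping_algebra\<^esub> a \<in> comm_proj ` X" if "a \<in> comm_proj ` X" for a
      using that neg by (auto simp: comm_proj_uminus)
    show "a \<oplus>\<^bsub>restricted_enveloping_algebra\<^esub> b \<in> comm_proj ` X"
      if "a \<in> comm_proj ` X" "b \<in> comm_proj ` X" for a b
      using that assms(2) by (auto simp: comm_proj_add[symmetric])
  qed auto
  then show ?thesis
    using assms(3)
    by (auto simp: left_ideal_def carrier_eq_range_comm_proj comm_proj_mult[symmetric]
        intro: additive_subgroup.intro)
qed

text \<open>Otherwise \<open>1 = m + x * f\<close> holds in u(L) with \<open>m\<close> in the ideal.
  Multiplying by powers of \<open>f\<close> and descending from the vanishing \<open>n\<close>-th
  power puts all lower powers into the ideal, down to the zeroth, which is \<open>1\<close>.\<close>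

lemma nilpotent_in_maximal_left_ideal:
  assumes J: "maximal_left_ideal J restricted_enveloping_algebra"
    and f: "comm_proj (f ^ n) = \<zero>\<^bsub>restricted_enveloping_algebra\<^esub>"
  shows "comm_proj f \<in> J"
proof (rule ccontr)
  assume notin: "comm_proj f \<notin> J"
  have left: "left_ideal J restricted_enveloping_algebra" using J by (simp add: maximal_left_ideal_def)
  note J' = left_ideal_preimage[OF left]
  let ?X = "{m + x * f | m x. comm_proj m \<in> J}"
  have mem: "m + x * f \<in> ?X" if "comm_proj m \<in> J" for m x using that by blast
  have "left_ideal (comm_proj ` ?X) restricted_enveloping_algebra"
  proof (rule left_ideal_image)
    show "0 \<in> ?X" using J'(1) by (auto intro!: exI[of _ 0])
    show "u + v \<in> ?X" if "u \<in> ?X" "v \<in> ?X" for u v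
    proof -
      from that obtain m x m' x' where "u = m + x * f" "comm_proj m \<in> J"
        "v = m' + x' * f" "comm_proj m' \<in> J" by blast
      then have "u + v = (m + m') + (x + x') * f" "comm_proj (m + m') \<in> J"
        using J'(2) by (simp_all add: algebra_simps)
      then show ?thesis by blast
    qed
    show "v * u \<in> ?X" if "u \<in> ?X" for u v
    proof -
      from that obtain m x where "u = m + x * f" "comm_proj m \<in> J" by blast
      then have "v * u = v * m + (v * x) * f" "comm_proj (v * m) \<in> J"
        using J'(3) by (simp_all add: algebra_simps)
      then show ?thesis by blast
    qed
  qed
  moreover have "J \<subseteq> comm_proj ` ?X"
  proof
    fix y assume "y \<in> J"
    then obtain g where "y = comm_proj g" "comm_proj g \<in> J"
      using J'(4) by (auto simp: carrier_eq_range_comm_proj)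
    with mem[of g 0] show "y \<in> comm_proj ` ?X" by simp
  qed
  ultimately have "comm_proj ` ?X = J \<or> comm_proj ` ?X = carrier restricted_enveloping_algebra"
    using J by (simp only: maximal_left_ideal_def)
  moreover have "comm_proj f \<in> comm_proj ` ?X"
    using mem[OF J'(1), of 1] by simp
  ultimately have "comm_proj ` ?X = carrier restricted_enveloping_algebra"
    using notin by (elim disjE) simp_all
  then have "comm_proj 1 \<in> comm_proj ` ?X" by simp
  then obtain m x where m: "comm_proj 1 = comm_proj (m + x * f)" "comm_proj m \<in> J"
    by (elim imageE CollectE exE conjE) simp
  have "k \<le> n \<Longrightarrow> comm_proj (f ^ (n - k)) \<in> J" for k
  proof (induction k)
    case 0
    then show ?case using f J'(1) by (simp add: comm_proj_zero)
  next
    case (Suc k)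
    then have k: "n - k = Suc (n - Suc k)" by simp
    have "comm_proj (f ^ (n - Suc k) * 1) = comm_proj (f ^ (n - Suc k) * (m + x * f))"
      by (rule comm_proj_mult_cong[OF refl m(1)])
    also have "f ^ (n - Suc k) * (m + x * f) = f ^ (n - Suc k) * m + x * f ^ (n - k)"
      by (simp add: k algebra_simps)
    also have "comm_proj \<dots> \<in> J" using Suc J'(2,3) m(2) by simp
    finally show ?case by simp
  qed
  from this[of n] have "comm_proj 1 \<in> J" by simp
  from J'(3)[OF this, of f] notin show False by simp
qed

text \<open>The full preimage of the augmentation ideal under \<open>comm_proj\<close>. The
  polynomial \<open>r\<close> in the chain variables is only required to exist, as the truncation
  relations make it non-unique; properness of the ideal then comes from independence of the
  monomials.\<close>

definition augmentation :: "('l multiset \<Rightarrow>\<^sub>0 'f) set" where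
  "augmentation = {g. \<exists>r. Poly_Mapping.lookup r {#} = 0 \<and> comm_proj g = comm_proj (subst r)}"

lemma subst_in_augmentation: "Poly_Mapping.lookup r {#} = 0 \<Longrightarrow> subst r \<in> augmentation"
  by (auto simp: augmentation_def)

lemma empty_in_exponents: "{#} \<in> exponents"
  using p_pos by (simp add: exponents_def)

lemma one_notin_augmentation: "comm_proj 1 \<notin> comm_proj ` augmentation"
proof
  assume "comm_proj 1 \<in> comm_proj ` augmentation"
  then obtain r where r: "Poly_Mapping.lookup r {#} = 0" "comm_proj 1 = comm_proj (subst r)"
    by (auto simp: augmentation_def)
  let ?S = "Poly_Mapping.keys r \<inter> exponents"
  \<comment> \<open>Writing \<open>1\<close> as a combination of nontrivial monomials gives a
    relation in which the empty monomial has coefficient \<open>- 1\<close>.\<close>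
  let ?c = "\<lambda>M. if M = {#} then - 1 else Poly_Mapping.lookup r M"
  have notin: "{#} \<notin> ?S" using r(1) by (simp add: in_keys_iff)
  have "(\<Sum>M\<in>insert {#} ?S. Poly_Mapping.single 0 (?c M) * gen_prod M) =
      (\<Sum>M\<in>?S. Poly_Mapping.single 0 (?c M) * gen_prod M) - 1"
    using notin by (simp add: gen_prod_empty single_uminus)
  also have "(\<Sum>M\<in>?S. Poly_Mapping.single 0 (?c M) * gen_prod M) =
      (\<Sum>M\<in>?S. Poly_Mapping.single 0 (Poly_Mapping.lookup r M) * gen_prod M)"
    using notin by (intro sum.cong) auto
  also have "comm_proj (\<dots> - 1) = \<zero>\<^bsub>restricted_enveloping_algebra\<^esub>"
    using r(2) by (simp add: comm_proj_eq_iff[symmetric] comm_proj_subst)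
  finally have "?c {#} = 0"
    using empty_in_exponents by (intro gen_prod_independent[of "insert {#} ?S" ?c]) auto
  then show False by simp
qed

text \<open>An element outside has a representative with constant term \<open>a \<noteq> 0\<close>,
  and the rest of it lies in the augmentation ideal. So a left ideal containing both contains the
  invertible scalar \<open>a\<close>.\<close>

lemma maximal_augmentation:
  "maximal_left_ideal (comm_proj ` augmentation) restricted_enveloping_algebra"
  unfolding maximal_left_ideal_def
proof (intro conjI allI impI)
  show "left_ideal (comm_proj ` augmentation) restricted_enveloping_algebra"
  proof (rule left_ideal_image)
    show "0 \<in> augmentation"
      using subst_in_augmentation[of 0] subst_sum[of "\<lambda>_. 0" "{}"] by simp
    show "f + g \<in> augmentation" if fg: "f \<in> augmentation" "g \<in> augmentation" for f g
    proof -
      from fg obtain r s where "Poly_Mapping.lookup r {#} = 0" "comm_proj f = comm_proj (subst r)"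
        "Poly_Mapping.lookup s {#} = 0" "comm_proj g = comm_proj (subst s)"
        by (auto simp: augmentation_def)
      then show ?thesis unfolding augmentation_def
        by (intro CollectI exI[of _ "r + s"]) (simp add: lookup_add subst_add comm_proj_add)
    qed
    show "g * f \<in> augmentation" if f: "f \<in> augmentation" for f g
    proof -
      from f obtain r where "Poly_Mapping.lookup r {#} = 0" "comm_proj f = comm_proj (subst r)"
        by (auto simp: augmentation_def)
      moreover obtain s where "comm_proj g = comm_proj (subst s)" using subst_surj by blast
      ultimately show ?thesis unfolding augmentation_def
        by (intro CollectI exI[of _ "s * r"]) (simp add: lookup_mult_empty subst_mult comm_proj_mult)
    qed
  qed
  show "comm_proj ` augmentation \<noteq> carrier restricted_enveloping_algebra"
    using one_notin_augmentation comm_proj_closed by blast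
  fix J assume J: "left_ideal J restricted_enveloping_algebra \<and> comm_proj ` augmentation \<subseteq> J"
  then have left: "left_ideal J restricted_enveloping_algebra" by simp
  note J' = left_ideal_preimage[OF left]
  show "J = comm_proj ` augmentation \<or> J = carrier restricted_enveloping_algebra"
  proof (cases "J \<subseteq> comm_proj ` augmentation")
    case True
    then show ?thesis using J by blast
  next
    case False
    then obtain y where y: "y \<in> J" "y \<notin> comm_proj ` augmentation" by blast
    then obtain g where "y = comm_proj g" using J'(4) by (auto simp: carrier_eq_range_comm_proj)
    with y have g: "comm_proj g \<in> J" "comm_proj g \<notin> comm_proj ` augmentation" by simp_all
    obtain r where r: "comm_proj g = comm_proj (subst r)" using subst_surj by blast
    define a where "a = Poly_Mapping.lookup r {#}"
    have "a \<noteq> 0"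
    proof
      assume "a = 0"
      then have "subst r \<in> augmentation" by (simp add: a_def subst_in_augmentation)
      then show False using g(2) r by simp
    qed
    have "subst (Poly_Mapping.single {#} a - r) \<in> augmentation"
      by (rule subst_in_augmentation) (simp add: lookup_minus a_def)
    then have "comm_proj (subst (Poly_Mapping.single {#} a - r)) \<in> J" using J by blast
    then have "comm_proj (subst (Poly_Mapping.single {#} a - r) + subst r) \<in> J"
      using J'(2) g(1) r by simp
    then have "comm_proj (Poly_Mapping.single 0 a) \<in> J"
      by (simp add: subst_add[symmetric] subst_single gen_prod_empty)
    from J'(3)[OF this, of "Poly_Mapping.single 0 (inverse a)"] have "comm_proj 1 \<in> J"
      using \<open>a \<noteq> 0\<close> by (simp add: mult_single)
    then have "comm_proj f \<in> J" for f using J'(3)[of 1 f] by simp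
    then have "J = carrier restricted_enveloping_algebra"
      using J'(4) by (auto simp: carrier_eq_range_comm_proj)
    then show ?thesis by simp
  qed
qed

text \<open>By commutativity, a single nilpotent factor makes the whole product nilpotent.\<close>

lemma monomial_in_maximal_left_ideal:
  assumes "maximal_left_ideal J restricted_enveloping_algebra" "M \<noteq> {#}"
  shows "monomial M \<in> J"
proof -
  obtain i N where M: "M = add_mset i N" using assms(2) by (cases M) auto
  have "comm_proj (gen_prod M ^ (p ^ e i)) = \<zero>\<^bsub>restricted_enveloping_algebra\<^esub>"
    using comm_proj_mult_eq_zero[OF comm_proj_gen_nilpotent]
    by (simp add: M gen_prod_def power_mult_distrib)
  then show ?thesis unfolding monomial_def by (rule nilpotent_in_maximal_left_ideal[OF assms(1)])
qed

text \<open>The augmentation ideal is a maximal left ideal and so contains the radical; conversely,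
  nontrivial monomials are nilpotent and so lie in every maximal left ideal.\<close>

lemma jacobson_radical_eq:
  "jacobson_radical restricted_enveloping_algebra = A.span (monomial ` (exponents - {{#}}))"
proof
  show "jacobson_radical restricted_enveloping_algebra \<subseteq> A.span (monomial ` (exponents - {{#}}))"
  proof
    fix x assume "x \<in> jacobson_radical restricted_enveloping_algebra"
    then have "x \<in> comm_proj ` augmentation"
      using maximal_augmentation by (auto simp: jacobson_radical_def)
    then obtain r where r: "Poly_Mapping.lookup r {#} = 0" "x = comm_proj (subst r)"
      by (auto simp: augmentation_def)
    show "x \<in> A.span (monomial ` (exponents - {{#}}))"
      unfolding r(2) comm_proj_subst
      using r(1) by (intro in_span_monomials) (auto simp: in_keys_iff)
  qed
  show "A.span (monomial ` (exponents - {{#}})) \<subseteq> jacobson_radical restricted_enveloping_algebra"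
  proof
    fix x assume "x \<in> A.span (monomial ` (exponents - {{#}}))"
    then obtain a S' where S': "x = A.lincomb a S'" "finite S'" "S' \<subseteq> monomial ` (exponents - {{#}})"
      unfolding A.span_def by blast
    obtain S where S: "S \<subseteq> exponents - {{#}}" "finite S" "S' = monomial ` S"
      using finite_subset_image[OF S'(2,3)] by blast
    then have x: "x = comm_proj (\<Sum>M\<in>S. Poly_Mapping.single 0 (a (monomial M)) * gen_prod M)"
      using S'(1) lincomb_monomial[of S a] by auto
    have "x \<in> J" if J: "maximal_left_ideal J restricted_enveloping_algebra" for J
    proof -
      have "left_ideal J restricted_enveloping_algebra" using J by (simp add: maximal_left_ideal_def)
      note J' = left_ideal_preimage[OF this]
      have "comm_proj (gen_prod M) \<in> J" if "M \<in> S" for M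
        using monomial_in_maximal_left_ideal[OF J, of M] that S(1) by (auto simp: monomial_def)
      then have "comm_proj (\<Sum>M\<in>S. Poly_Mapping.single 0 (a (monomial M)) * gen_prod M) \<in> J"
      proof (induction S rule: infinite_finite_induct)
        case (insert M S)
        then show ?case using J'(2,3) by simp
      qed (use J'(1) in simp_all)
      then show ?thesis by (simp add: x)
    qed
    then show "x \<in> jacobson_radical restricted_enveloping_algebra"
      by (auto simp: jacobson_radical_def x)
  qed
qed

lemma filtered_multiplicative_basis_monomials:
  "filtered_multiplicative_basis class_ring restricted_enveloping_algebra (monomial ` exponents)"
  unfolding filtered_multiplicative_basis_def
proof (intro conjI ballI)
  let ?R = "jacobson_radical restricted_enveloping_algebra"
  let ?B = "monomial ` (exponents - {{#}})"
  show "A.basis (monomial ` exponents)" by (rule basis_monomials)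
  show "b \<otimes>\<^bsub>restricted_enveloping_algebra\<^esub> b' = \<zero>\<^bsub>restricted_enveloping_algebra\<^esub> \<or>
      b \<otimes>\<^bsub>restricted_enveloping_algebra\<^esub> b' \<in> monomial ` exponents"
    if "b \<in> monomial ` exponents" "b' \<in> monomial ` exponents" for b b'
    using that monomial_mult by blast
  have sub: "submodule class_ring ?R restricted_enveloping_algebra"
    unfolding jacobson_radical_eq by (rule A.span_is_submodule[OF monomials_subset_carrier])
  have B_sub: "?B \<subseteq> ?R"
    unfolding jacobson_radical_eq by (rule A.in_own_span[OF monomials_subset_carrier])
  \<comment> \<open>Only the unit has to be kept out, as the other monomials are already known to
    lie in the radical.\<close>
  have "monomial {#} \<notin> ?R"
  proof
    assume "monomial {#} \<in> ?R"
    then have "comm_proj 1 \<in> comm_proj ` augmentation"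
      using maximal_augmentation by (auto simp: jacobson_radical_def monomial_def gen_prod_empty)
    then show False using one_notin_augmentation by blast
  qed
  then have inter: "monomial ` exponents \<inter> ?R = ?B" using B_sub by blast
  have "VectorSpace.subspace class_ring ?R restricted_enveloping_algebra"
    using sub by (intro VectorSpace.subspace.intro A.vectorspace_axioms)
  then have "vectorspace class_ring (restricted_enveloping_algebra\<lparr>carrier := ?R\<rparr>)"
    by (rule A.subspace_is_vs)
  then show "vectorspace.basis class_ring (restricted_enveloping_algebra\<lparr>carrier := ?R\<rparr>)
      (monomial ` exponents \<inter> ?R)"
    unfolding inter
    using A.span_li_not_depend[OF B_sub sub] B_sub monomials_independent[of "exponents - {{#}}"]
    by (simp add: vectorspace.basis_def jacobson_radical_eq)
qed

end

lemma chain_basis_imp_filtered_multiplicative_basis: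
  assumes "chain_basis I h e"
  shows "has_filtered_multiplicative_basis class_ring restricted_enveloping_algebra"
proof -
  \<comment> \<open>The monomial construction uses multisets over the whole index type, so the chain
    data are extended by \<open>0\<close> outside \<open>I\<close>; this leaves every combination
    unchanged.\<close>
  let ?h = "\<lambda>i. if i \<in> I then h i else 0" and ?e = "\<lambda>i. if i \<in> I then e i else 0"
  have "chain_comb I ?h ?e = chain_comb I h e"
    by (intro ext) (simp add: chain_comb_def)
  then have "chain_basis I ?h ?e"
    using assms by (simp add: chain_basis_def)
  from filtered_multiplicative_basis_monomials[OF this] show ?thesis
    unfolding has_filtered_multiplicative_basis_def by auto
qed

end

theorem theorem1:
  fixes scale :: "'f::field \<Rightarrow> 'l::ab_group_add \<Rightarrow> 'l"
    and bracket :: "'l \<Rightarrow> 'l \<Rightarrow> 'l"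
    and p :: nat
    and pmap :: "'l \<Rightarrow> 'l"
  assumes "restricted_lie_algebra scale bracket p pmap"
    and "lie_algebra.finite_dimensional scale"
    and "restricted_lie_algebra.p_nilpotent pmap"
    and "lie_algebra.abelian bracket"
  shows "(has_filtered_multiplicative_basis class_ring
            (restricted_lie_algebra.restricted_enveloping_algebra scale bracket p pmap) \<longleftrightarrow>
          restricted_lie_algebra.decomposes_into_cyclics scale bracket pmap) \<and>
         (perfect_field TYPE('f) \<longrightarrow>
          has_filtered_multiplicative_basis class_ring
            (restricted_lie_algebra.restricted_enveloping_algebra scale bracket p pmap))"
proof -
  interpret restricted_lie_algebra scale bracket p pmap by (rule assms(1))
  interpret abelian_restricted_lie_algebra scale bracket p pmap
    by unfold_locales (use assms(4) in \<open>simp add: abelian_def\<close>)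
  obtain n where n: "n \<ge> 1" "\<And>x. (pmap ^^ n) x = 0"
    using uniform_nilpotency assms(2,3) by blast
  have liftable_imp: "decomposes_into_cyclics" if "relations_liftable"
    using relations_liftable_imp_chain_basis[OF that assms(2,3)] chain_basis_imp_decomposes by metis
  have imp_liftable: "relations_liftable"
    if "has_filtered_multiplicative_basis class_ring restricted_enveloping_algebra"
    using that multiplicative_basis_imp_relations_liftable[OF n]
    unfolding has_filtered_multiplicative_basis_def filtered_multiplicative_basis_def by blast
  have "has_filtered_multiplicative_basis class_ring restricted_enveloping_algebra"
    if "decomposes_into_cyclics"
    using decomposes_imp_chain_basis[OF that assms(3)] chain_basis_imp_filtered_multiplicative_basis
    by metis
  \<comment> \<open>The perfect case runs through the same implications: perfectness gives
    liftability, hence a decomposition, hence a basis.\<close>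
  then show ?thesis
    using liftable_imp imp_liftable perfect_imp_relations_liftable by blast
qed

end
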